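(* Let $\mathcal{U}_{-}$ be the set of all $(a,b)\in\mathbb{R}^2$ such that $\sqrt{2}<a<2$ and $$\max\left\{\tfrac{1}{8}\left(3a^2-8a+\sqrt{9a^4-16a^3}\right),\ 2-\sqrt{2}\,a\right\}<b<0,$$ where the first entry of the maximum is taken into account only when it is a real number (i.e. when $a\ge 16/9$). For $(a,b)\in\mathcal{U}_-$ let $f=f_{(a,b)}$ be the Lozi map, let $X=\left(\frac{1}{1+a-b},\frac{b}{1+a-b}\right)$ be its fixed point, and let $\mathcal{A}_{(a,b)}=\overline{W^u_X}$ be the closure of the unstable manifold of $X$. Then there exists an open set $\mathcal{U}_{\mathrm{tan}}\subset\mathcal{U}_{-}$ accumulating on $(2,0)$ (i.e. having $(2,0)$ as an accumulation point) such that $\mathcal{A}_{(a,b)}$ is a strange attractor for $f_{(a,b)}$ whenever $(a,b)\in\mathcal{U}_{\mathrm{tan}}$. Additionally, the attractors $\mathcal{A}_{(a,b)}$ depend continuously on $(a,b)\in\mathcal{U}_{\mathrm{tan}}$ with respect to the Hausdorff metric.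
   Context: The Lozi map is $f_{(a,b)}:\mathbb{R}^2\to\mathbb{R}^2$, $f_{(a,b)}(x,y)=(1+y-a|x|,\,bx)$; for $b\neq0$ it is a homeomorphism. For a homeomorphism $g$ of a metric space $(M,d)$, a local unstable manifold at $q$ is a set $W^u_{q,\epsilon,loc}=\{r\in M:\lim_{n\to\infty}d(g^{-n}(q),g^{-n}(r))=0 \text{ and } d(g^{-i}(q),g^{-i}(r))<\epsilon \text{ for every } i\in\mathbb{N}\}$ for some $\epsilon>0$; the (global) unstable manifold is $W^u_q=\bigcup_{n\in\mathbb{N}}g^n(W^u_{g^{-n}(q),loc})$. For a continuous map $h:S\to S$, an open set $U\subset S$ is a trapping region if $h(\overline{U})\subset U$. A compact set $F$ contained in a trapping region $U$ with $\bigcap_{n\in\mathbb{N}}h^n(U)=F$ is called maximal in $U$. A compact invariant set $F$ is a strange attractor if it has a trapping region in which it is maximal. The Hausdorff distance of $P,Q\subset\mathbb{R}^2$ is $d_H(P,Q)=\max\{\sup_{p\in P}\inf_{q\in Q}d(p,q),\ \sup_{q\in Q}\inf_{p\in P}d(p,q)\}$. *)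

theory Defs
  imports "HOL-Analysis.Analysis"
begin

definition lozi :: "real \<times> real \<Rightarrow> real \<times> real \<Rightarrow> real \<times> real" where
  "lozi = (\<lambda>(a, b) (x, y). (1 + y - a * \<bar>x\<bar>, b * x))"

lemma lozi_homeomorphism:
  assumes "b \<noteq> 0"
  shows "homeomorphism UNIV UNIV (lozi (a, b)) (inv (lozi (a, b)))"
proof -
  define g where "g = (\<lambda>(u, v). (v / b, u - 1 + a * \<bar>v / b\<bar>) :: real \<times> real)"
  have gf: "g (lozi (a, b) z) = z" and fg: "lozi (a, b) (g z) = z" for z
    using assms by (simp_all add: g_def lozi_def case_prod_beta abs_mult)
  have "inv (lozi (a, b)) = g"
    by (rule inv_equality) (rule gf fg)+
  moreover have "continuous_on UNIV (lozi (a, b))"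
    unfolding lozi_def case_prod_beta by (intro continuous_intros)
  moreover have "continuous_on UNIV g"
    unfolding g_def case_prod_beta using assms by (intro continuous_intros) auto
  ultimately show ?thesis
    by (intro homeomorphismI) (simp_all add: gf fg)
qed

definition lozi_fixed_point :: "real \<times> real \<Rightarrow> real \<times> real" where
  "lozi_fixed_point = (\<lambda>(a, b). (1 / (1 + a - b), b / (1 + a - b)))"

lemma lozi_fixed_point:
  assumes "0 < 1 + a - b"
  shows "lozi (a, b) (lozi_fixed_point (a, b)) = lozi_fixed_point (a, b)"
proof -
  define d where "d = 1 + a - b"
  have "1 + b / d - a * (1 / d) = 1 / d"
    using assms by (simp add: d_def divide_simps)
  then show ?thesis
    using assms by (simp add: lozi_def lozi_fixed_point_def abs_of_pos flip: d_def)
qed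

text \<open>Negative iterates of a homeomorphism \<open>g\<close> are written as \<open>inv g ^^ n\<close>; the map is
  intended to be bijective.\<close>

definition local_unstable_manifold ::
    "('a::metric_space \<Rightarrow> 'a) \<Rightarrow> real \<Rightarrow> 'a \<Rightarrow> 'a set" where
  "local_unstable_manifold g \<epsilon> q =
    {r. (\<lambda>n. dist ((inv g ^^ n) q) ((inv g ^^ n) r)) \<longlonglongrightarrow> 0 \<and>
        (\<forall>i. dist ((inv g ^^ i) q) ((inv g ^^ i) r) < \<epsilon>)}"

text \<open>The union is taken over all admissible \<open>\<epsilon>\<close>; by \<open>unstable_manifold_eq\<close> below, any single
  \<open>\<epsilon> > 0\<close> yields the same set.\<close>

definition unstable_manifold :: "('a::metric_space \<Rightarrow> 'a) \<Rightarrow> 'a \<Rightarrow> 'a set" where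
  "unstable_manifold g q =
    (\<Union>\<epsilon>\<in>{0<..}. \<Union>n. (g ^^ n) ` local_unstable_manifold g \<epsilon> ((inv g ^^ n) q))"

lemma unstable_manifold_eq:
  fixes g :: "'a::metric_space \<Rightarrow> 'a"
  assumes "bij g" and "\<epsilon> > 0"
  shows "unstable_manifold g q =
    (\<Union>n. (g ^^ n) ` local_unstable_manifold g \<epsilon> ((inv g ^^ n) q))"
proof -
  let ?D = "\<lambda>r n. dist ((inv g ^^ n) q) ((inv g ^^ n) r)"
  have inv1: "(inv g ^^ n) ((g ^^ n) z) = z" and inv2: "(g ^^ n) ((inv g ^^ n) z) = z" for n z
    using bij_fn[OF assms(1), of n] unfolding inv_fn[OF assms(1), symmetric]
    by (simp_all add: bij_is_inj bij_is_surj surj_f_inv_f)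
  have add: "(inv g ^^ i) ((inv g ^^ n) z) = (inv g ^^ (i + n)) z" for i n z
    by (simp add: funpow_add)
  have eq: "(\<Union>n. (g ^^ n) ` local_unstable_manifold g e ((inv g ^^ n) q)) =
      {r. ?D r \<longlonglongrightarrow> 0}" if e: "e > 0" for e
  proof (intro equalityI subsetI)
    fix r
    assume "r \<in> (\<Union>n. (g ^^ n) ` local_unstable_manifold g e ((inv g ^^ n) q))"
    then obtain n s where s: "r = (g ^^ n) s"
      "s \<in> local_unstable_manifold g e ((inv g ^^ n) q)" by blast
    have "s = (inv g ^^ n) r" by (simp add: s(1) inv1)
    with s(2) have "(\<lambda>i. ?D r (i + n)) \<longlonglongrightarrow> 0"
      by (simp add: local_unstable_manifold_def add)
    then show "r \<in> {r. ?D r \<longlonglongrightarrow> 0}"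
      by (simp add: LIMSEQ_offset)
  next
    fix r
    assume "r \<in> {r. ?D r \<longlonglongrightarrow> 0}"
    then have lim: "?D r \<longlonglongrightarrow> 0" by simp
    then obtain n where n: "\<And>i. i \<ge> n \<Longrightarrow> ?D r i < e"
      using order_tendstoD(2)[OF lim e] by (auto simp: eventually_sequentially)
    have "(inv g ^^ n) r \<in> local_unstable_manifold g e ((inv g ^^ n) q)"
      using LIMSEQ_ignore_initial_segment[OF lim, of n] n
      by (simp add: local_unstable_manifold_def add)
    then show "r \<in> (\<Union>n. (g ^^ n) ` local_unstable_manifold g e ((inv g ^^ n) q))"
      by (intro UN_I[of n] image_eqI[of _ _ "(inv g ^^ n) r"]) (simp_all add: inv2)
  qed
  have "unstable_manifold g q = (\<Union>e\<in>{0::real<..}. {r. ?D r \<longlonglongrightarrow> 0})"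
    unfolding unstable_manifold_def by (rule SUP_cong) (simp_all only: greaterThan_iff eq)
  also have "\<dots> = {r. ?D r \<longlonglongrightarrow> 0}"
    using assms(2) by (intro UN_constant[THEN trans]) auto
  also have "\<dots> = (\<Union>n. (g ^^ n) ` local_unstable_manifold g \<epsilon> ((inv g ^^ n) q))"
    by (rule eq[OF assms(2), symmetric])
  finally show ?thesis .
qed

definition trapping_region :: "('a::topological_space \<Rightarrow> 'a) \<Rightarrow> 'a set \<Rightarrow> bool" where
  "trapping_region h U \<longleftrightarrow> open U \<and> h ` closure U \<subseteq> U"

definition maximal_in :: "('a::topological_space \<Rightarrow> 'a) \<Rightarrow> 'a set \<Rightarrow> 'a set \<Rightarrow> bool" where
  "maximal_in h U F \<longleftrightarrow>
    trapping_region h U \<and> compact F \<and> F \<subseteq> U \<and> (\<Inter>n. (h ^^ n) ` U) = F"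

definition strange_attractor :: "('a::topological_space \<Rightarrow> 'a) \<Rightarrow> 'a set \<Rightarrow> bool" where
  "strange_attractor h F \<longleftrightarrow> compact F \<and> h ` F = F \<and> (\<exists>U. maximal_in h U F)"

text \<open>Meaningful for nonempty bounded sets only, since \<open>SUP\<close> and \<open>INF\<close> are those of the type
  \<open>real\<close>.\<close>

definition hausdorff_distance :: "'a::metric_space set \<Rightarrow> 'a set \<Rightarrow> real" where
  "hausdorff_distance P Q =
    max (SUP p\<in>P. INF q\<in>Q. dist p q) (SUP q\<in>Q. INF p\<in>P. dist p q)"

text \<open>The square root in the lower bound for \<open>b\<close> is real iff \<open>9 * a ^ 4 - 16 * a ^ 3 \<ge> 0\<close>, which
  for \<open>a > 0\<close> means \<open>a \<ge> 16 / 9\<close>.\<close>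

definition U_minus :: "(real \<times> real) set" where
  "U_minus = {(a, b). sqrt 2 < a \<and> a < 2 \<and>
    (if a \<ge> 16 / 9
     then max ((3 * a\<^sup>2 - 8 * a + sqrt (9 * a ^ 4 - 16 * a ^ 3)) / 8) (2 - sqrt 2 * a)
     else 2 - sqrt 2 * a) < b \<and> b < 0}"

definition lozi_attractor :: "real \<times> real \<Rightarrow> (real \<times> real) set" where
  "lozi_attractor p = closure (unstable_manifold (lozi p) (lozi_fixed_point p))"

end

theory Submission
  imports Defs
begin

text \<open>
  Write \<open>a = \<kappa> + \<nu>\<close> and \<open>b = - \<kappa> \<nu>\<close>, so that the linear parts of the map have eigenvalues
  \<open>\<plusminus>\<kappa>\<close> and \<open>\<plusminus>\<nu>\<close>. Near \<open>(2, 0)\<close> we have \<open>\<kappa> \<approx> 2\<close>, and we take \<open>\<nu>\<close> much smaller than \<open>2 - \<kappa>\<close>; then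
  a thin box \<open>U\<close> is a trapping region. It remains to show that every point of the maximal
  invariant set \<open>G\<close> of \<open>U\<close> lies in the closure of the unstable manifold \<open>W\<close> of the fixed point \<open>X\<close>.

  Two pieces of stable leaves of \<open>X\<close>, near \<open>x = -1/3\<close> and \<open>x = 1/6\<close>, bound a window which every
  backward orbit in \<open>G\<close> visits infinitely often, unless the orbit lies in \<open>W\<close>. The parameter
  \<open>\<kappa>\<close> is chosen such that the \<open>m + 2\<close>-nd image of the critical line \<open>x = 0\<close> falls just to the left
  of the window. Therefore the return map along the itinerary right, right, \<open>m\<close> times left maps straight
  pieces of \<open>W\<close> across the window to straight pieces across the window, and these accumulate on
  the upper envelope of \<open>G\<close>; their images under left, then right, accumulate on the lower
  envelope. So a point of \<open>G\<close> in the window that is not in the closure of \<open>W\<close> lies in a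
  quadrilateral bounded by two pieces of \<open>W\<close> and two stable leaves. As the map contracts area,
  the preimages of a small disc around a point outside the closure of \<open>W\<close> cannot stay in such
  quadrilaterals, hence they meet the stable leaves, whose forward images shrink to \<open>X\<close>, a contradiction.

  Upper semicontinuity of the attractor follows from the description by backward orbits in the
  box, lower semicontinuity from the continuity of the local unstable segment at \<open>X\<close>.
\<close>

section \<open>Homeomorphisms and their maximal invariant sets\<close>

lemma funpow_inv_cancel:
  assumes "bij f"
  shows "(f ^^ n) ((inv f ^^ n) z) = z" "(inv f ^^ n) ((f ^^ n) z) = z"
  using bij_fn[OF assms, of n] unfolding inv_fn[OF assms, symmetric]
  by (simp_all add: bij_is_inj bij_is_surj surj_f_inv_f)

lemma funpow_inv_Suc:
  assumes "bij f"
  shows "f ((inv f ^^ Suc n) z) = (inv f ^^ n) z"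
  using assms by (simp add: bij_is_surj surj_f_inv_f)

text \<open>Since q is fixed, the union over n only asks that some tail of the backward orbit stay
  near q. Convergence supplies such a tail, so the \<epsilon> condition disappears.\<close>

lemma unstable_manifold_fixed_point:
  fixes g :: "'a::metric_space \<Rightarrow> 'a"
  assumes "bij g" and "g q = q"
  shows "unstable_manifold g q = {r. (\<lambda>n. (inv g ^^ n) r) \<longlonglongrightarrow> q}"
proof -
  have "inv g q = q"
    using assms by (metis bij_inv_eq_iff)
  then have fixq: "(inv g ^^ n) q = q" for n
    by (induction n) auto
  have add: "(inv g ^^ i) ((inv g ^^ n) z) = (inv g ^^ (i + n)) z" for i n z
    by (simp add: funpow_add)
  have "r \<in> unstable_manifold g q \<longleftrightarrow> (\<lambda>n. (inv g ^^ n) r) \<longlonglongrightarrow> q" for r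
  proof
    assume "r \<in> unstable_manifold g q"
    then obtain n s e where s: "r = (g ^^ n) s" "s \<in> local_unstable_manifold g e q"
      unfolding unstable_manifold_def by (auto simp: fixq)
    have "s = (inv g ^^ n) r"
      by (simp add: s(1) funpow_inv_cancel[OF assms(1)])
    with s(2) have "(\<lambda>i. dist q ((inv g ^^ (i + n)) r)) \<longlonglongrightarrow> 0"
      by (simp add: local_unstable_manifold_def add fixq)
    then have "(\<lambda>i. (inv g ^^ (i + n)) r) \<longlonglongrightarrow> q"
      by (subst tendsto_dist_iff) (simp add: dist_commute)
    then show "(\<lambda>n. (inv g ^^ n) r) \<longlonglongrightarrow> q"
      by (rule LIMSEQ_offset)
  next
    assume "(\<lambda>n. (inv g ^^ n) r) \<longlonglongrightarrow> q"
    then have lim: "(\<lambda>n. dist q ((inv g ^^ n) r)) \<longlonglongrightarrow> 0"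
      by (subst (asm) tendsto_dist_iff) (simp add: dist_commute)
    then obtain n where n: "\<And>i. i \<ge> n \<Longrightarrow> dist q ((inv g ^^ i) r) < 1"
      using order_tendstoD(2)[OF lim, of 1] by (auto simp: eventually_sequentially)
    have "(inv g ^^ n) r \<in> local_unstable_manifold g 1 q"
      using LIMSEQ_ignore_initial_segment[OF lim, of n] n
      by (simp add: local_unstable_manifold_def add fixq)
    then show "r \<in> unstable_manifold g q"
      unfolding unstable_manifold_def fixq
      by (intro UN_I[of 1] UN_I[of n] image_eqI[of _ _ "(inv g ^^ n) r"])
        (simp_all add: funpow_inv_cancel[OF assms(1)])
  qed
  then show ?thesis by auto
qed

lemma unstable_manifold_image_iff:
  fixes g :: "'a::metric_space \<Rightarrow> 'a"
  assumes "bij g" and "g q = q"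
  shows "(g ^^ n) r \<in> unstable_manifold g q \<longleftrightarrow> r \<in> unstable_manifold g q"
proof -
  have "(\<lambda>i. (inv g ^^ (i + n)) ((g ^^ n) r)) = (\<lambda>i. (inv g ^^ i) r)"
    using assms by (simp add: funpow_add funpow_inv_cancel)
  then show ?thesis
    using LIMSEQ_ignore_initial_segment[of "\<lambda>i. (inv g ^^ i) ((g ^^ n) r)" q n]
      LIMSEQ_offset[of "\<lambda>i. (inv g ^^ i) ((g ^^ n) r)" n q]
    unfolding unstable_manifold_fixed_point[OF assms] by auto
qed

text \<open>For a bijection this is the intersection of the images of U (\<open>max_inv_eq\<close>).
  The form by backward orbits makes invariance immediate and turns limits into pointwise
  conditions.\<close>

definition max_inv :: "('a::topological_space \<Rightarrow> 'a) \<Rightarrow> 'a set \<Rightarrow> 'a set" where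
  "max_inv f U = {z. \<forall>n. (inv f ^^ n) z \<in> U}"

lemma max_inv_subset: "max_inv f U \<subseteq> U"
proof
  fix z assume "z \<in> max_inv f U"
  then have "(inv f ^^ 0) z \<in> U" unfolding max_inv_def by blast
  then show "z \<in> U" by simp
qed

lemma max_inv_eq:
  assumes "bij f"
  shows "(\<Inter>n. (f ^^ n) ` U) = max_inv f U"
proof (intro set_eqI iffI)
  fix z assume z: "z \<in> (\<Inter>n. (f ^^ n) ` U)"
  show "z \<in> max_inv f U" unfolding max_inv_def
  proof (intro CollectI allI)
    fix n
    from z obtain w where "w \<in> U" "z = (f ^^ n) w" by blast
    then show "(inv f ^^ n) z \<in> U" using assms by (simp add: funpow_inv_cancel)
  qed
next
  fix z assume "z \<in> max_inv f U"
  then have "z \<in> (f ^^ n) ` U" for n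
    using funpow_inv_cancel(1)[OF assms, of n z, symmetric] by (auto simp: max_inv_def)
  then show "z \<in> (\<Inter>n. (f ^^ n) ` U)" by blast
qed

text \<open>Each point of a backward orbit is the image of the next one, and f maps the closure into
  U. The closed form of the condition gives compactness below.\<close>

lemma max_inv_closure:
  assumes "bij f" and "trapping_region f U"
  shows "max_inv f U = {z. \<forall>n. (inv f ^^ n) z \<in> closure U}"
proof (intro set_eqI iffI)
  fix z assume "z \<in> {z. \<forall>n. (inv f ^^ n) z \<in> closure U}"
  then have "f ((inv f ^^ Suc n) z) \<in> U" for n
    using assms(2) unfolding trapping_region_def by blast
  then show "z \<in> max_inv f U"
    by (simp only: max_inv_def funpow_inv_Suc[OF assms(1)] mem_Collect_eq simp_thms)
qed (use closure_subset in \<open>auto simp: max_inv_def\<close>)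

lemma max_inv_inv:
  assumes "z \<in> max_inv f U"
  shows "(inv f ^^ n) z \<in> max_inv f U"
proof -
  have "(inv f ^^ i) ((inv f ^^ n) z) = (inv f ^^ (i + n)) z" for i
    by (simp add: funpow_add)
  then show ?thesis using assms by (simp add: max_inv_def)
qed

lemma max_inv_image:
  assumes "bij f" and "trapping_region f U"
  shows "f ` max_inv f U = max_inv f U"
proof (intro set_eqI iffI)
  fix z assume "z \<in> f ` max_inv f U"
  then obtain w where w: "w \<in> max_inv f U" "z = f w" by blast
  have "(inv f ^^ n) z \<in> U" for n
  proof (cases n)
    case 0
    have "w \<in> U" using w(1) max_inv_subset by blast
    then show ?thesis
      using assms(2) 0 w(2) closure_subset unfolding trapping_region_def by auto
  next
    case (Suc k)
    then have "(inv f ^^ n) z = (inv f ^^ k) w"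
      using w(2) assms(1) by (simp add: funpow_swap1 bij_is_inj)
    then show ?thesis using w(1) by (simp add: max_inv_def)
  qed
  then show "z \<in> max_inv f U" by (simp add: max_inv_def)
next
  fix z assume "z \<in> max_inv f U"
  then have "inv f z \<in> max_inv f U" using max_inv_inv[of z f U 1] by simp
  moreover have "z = f (inv f z)" using assms(1) by (simp add: bij_is_surj surj_f_inv_f)
  ultimately show "z \<in> f ` max_inv f U" by blast
qed

lemma compact_max_inv:
  fixes f :: "'a::heine_borel \<Rightarrow> 'a"
  assumes "bij f" and "trapping_region f U" and "bounded U" and "continuous_on UNIV (inv f)"
  shows "compact (max_inv f U)"
proof -
  have cont: "continuous_on UNIV (inv f ^^ n)" for n
  proof (induction n)
    case (Suc n)
    have "continuous_on UNIV (inv f \<circ> (inv f ^^ n))"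
      by (rule continuous_on_compose[OF Suc continuous_on_subset[OF assms(4)]]) simp
    then show ?case by simp
  qed (simp add: id_def)
  have "max_inv f U = (\<Inter>n. (inv f ^^ n) -` closure U)"
    unfolding max_inv_closure[OF assms(1,2)] by auto
  moreover have "closed ((inv f ^^ n) -` closure U)" for n
    using continuous_closed_preimage[OF cont[of n] closed_UNIV closed_closure] by simp
  ultimately have "closed (max_inv f U)" by auto
  moreover have "max_inv f U \<subseteq> U" using max_inv_subset .
  ultimately show ?thesis using assms(3) bounded_subset compact_eq_bounded_closed by blast
qed

text \<open>A backward orbit converging to q is eventually in the open set U. Forward invariance of
  U then carries the membership back to the finitely many earlier indices.\<close>

lemma unstable_subset_max_inv:
  fixes f :: "'a::metric_space \<Rightarrow> 'a"
  assumes "bij f" "trapping_region f U" "f q = q" "q \<in> U"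
  shows "unstable_manifold f q \<subseteq> max_inv f U"
proof
  fix z assume "z \<in> unstable_manifold f q"
  then have lim: "(\<lambda>n. (inv f ^^ n) z) \<longlonglongrightarrow> q"
    by (simp add: unstable_manifold_fixed_point[OF assms(1,3)])
  have "open U" using assms(2) by (simp add: trapping_region_def)
  then obtain N where N: "\<And>n. n \<ge> N \<Longrightarrow> (inv f ^^ n) z \<in> U"
    using topological_tendstoD[OF lim _ assms(4)] by (auto simp: eventually_sequentially)
  have down: "(inv f ^^ n) z \<in> U" if "(inv f ^^ Suc n) z \<in> U" for n
    using that assms(2) closure_subset funpow_inv_Suc[OF assms(1), of n z]
    unfolding trapping_region_def by (metis image_subset_iff subsetD)
  have "(inv f ^^ n) z \<in> U" for n
  proof (cases "n \<ge> N")
    case False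
    then have "n \<le> N" by simp
    then show ?thesis
      by (induction rule: inc_induct) (use N down in blast)+
  qed (rule N)
  then show "z \<in> max_inv f U" by (simp add: max_inv_def)
qed

section \<open>Area and Hausdorff distance\<close>

text \<open>By Fubini the fold does no harm: on each horizontal line of the image, the first
  coordinate is a translate of the vertical coordinate of S, and the remaining variable is scaled by
  b.\<close>

lemma emeasure_lozi_image:
  assumes "b \<noteq> 0" and "compact S"
  shows "emeasure lborel (lozi (a, b) ` S) = ennreal \<bar>b\<bar> * emeasure lborel S"
proof -
  have hom: "homeomorphism UNIV UNIV (lozi (a, b)) (inv (lozi (a, b)))"
    using lozi_homeomorphism assms(1) by blast
  have "continuous_on UNIV (lozi (a, b))" using hom by (simp add: homeomorphism_def)
  then have cS: "compact (lozi (a, b) ` S)"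
    using assms(2) compact_continuous_image continuous_on_subset subset_UNIV by blast
  have Sb: "S \<in> sets borel" "lozi (a, b) ` S \<in> sets borel"
    using assms(2) cS by (auto intro: borel_compact)
  have iff: "(u, w) \<in> lozi (a, b) ` S \<longleftrightarrow> (w / b, u - 1 + a * \<bar>w / b\<bar>) \<in> S" for u w
  proof
    assume "(u, w) \<in> lozi (a, b) ` S"
    then show "(w / b, u - 1 + a * \<bar>w / b\<bar>) \<in> S"
      using assms(1) by (auto simp: lozi_def abs_mult)
  next
    assume *: "(w / b, u - 1 + a * \<bar>w / b\<bar>) \<in> S"
    have "(u, w) = lozi (a, b) (w / b, u - 1 + a * \<bar>w / b\<bar>)"
      using assms(1) by (simp add: lozi_def)
    with * show "(u, w) \<in> lozi (a, b) ` S" by blast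
  qed
  have m1: "(\<lambda>x. indicator (lozi (a, b) ` S) x :: ennreal) \<in> borel_measurable (lborel \<Otimes>\<^sub>M lborel)"
    and m2: "(\<lambda>x. indicator S x :: ennreal) \<in> borel_measurable (lborel \<Otimes>\<^sub>M lborel)"
    using Sb by (simp_all add: lborel_prod)
  have m2': "(\<lambda>x. indicator S x :: ennreal) \<in> borel_measurable (borel \<Otimes>\<^sub>M borel)"
    using Sb by (simp add: borel_prod)
  have meas: "(\<lambda>y. indicator S (t, y) :: ennreal) \<in> borel_measurable borel" for t
    by (rule measurable_compose[OF _ m2']) measurable
  have sl: "(\<lambda>t. \<integral>\<^sup>+ y. indicator S (t, y) \<partial>lborel :: ennreal) \<in> borel_measurable borel"
    using lborel.borel_measurable_nn_integral_fst[OF m2] by simp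
  have slb: "(\<lambda>w. \<integral>\<^sup>+ y. indicator S (w / b, y) \<partial>lborel :: ennreal) \<in> borel_measurable borel"
    by (rule measurable_compose[of "\<lambda>w. w / b" borel borel, OF _ sl]) simp
  have "emeasure lborel (lozi (a, b) ` S) = (\<integral>\<^sup>+ x. indicator (lozi (a, b) ` S) x \<partial>(lborel \<Otimes>\<^sub>M lborel))"
    using Sb by (simp add: lborel_prod)
  also have "\<dots> = (\<integral>\<^sup>+ w. \<integral>\<^sup>+ u. indicator (lozi (a, b) ` S) (u, w) \<partial>lborel \<partial>lborel)"
    using lborel_pair.nn_integral_snd[OF m1] by simp
  also have "\<dots> = (\<integral>\<^sup>+ w. \<integral>\<^sup>+ u. indicator S (w / b, u - 1 + a * \<bar>w / b\<bar>) \<partial>lborel \<partial>lborel)"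
    by (simp add: indicator_def iff)
  also have "\<dots> = (\<integral>\<^sup>+ w. \<integral>\<^sup>+ y. indicator S (w / b, y) \<partial>lborel \<partial>lborel)"
  proof (rule nn_integral_cong)
    fix w :: real
    have "(\<integral>\<^sup>+ y. indicator S (w / b, y) \<partial>lborel)
        = ennreal \<bar>1\<bar> * (\<integral>\<^sup>+ u. indicator S (w / b, (a * \<bar>w / b\<bar> - 1) + 1 * u) \<partial>lborel)"
      by (rule nn_integral_real_affine) (use meas in auto)
    then show "(\<integral>\<^sup>+ u. indicator S (w / b, u - 1 + a * \<bar>w / b\<bar>) \<partial>lborel)
        = (\<integral>\<^sup>+ y. indicator S (w / b, y) \<partial>lborel :: ennreal)"
      by (simp add: algebra_simps)
  qed
  also have "\<dots> = ennreal \<bar>b\<bar> * (\<integral>\<^sup>+ t. \<integral>\<^sup>+ y. indicator S (t, y) \<partial>lborel \<partial>lborel)"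
  proof -
    have "(\<integral>\<^sup>+ w. \<integral>\<^sup>+ y. indicator S (w / b, y) \<partial>lborel \<partial>lborel)
        = ennreal \<bar>b\<bar> * (\<integral>\<^sup>+ t. \<integral>\<^sup>+ y. indicator S ((0 + b * t) / b, y) \<partial>lborel \<partial>lborel)"
      by (rule nn_integral_real_affine[where f = "\<lambda>w. \<integral>\<^sup>+ y. indicator S (w / b, y) \<partial>lborel"])
        (use assms(1) slb in auto)
    then show ?thesis using assms(1) by simp
  qed
  also have "(\<integral>\<^sup>+ t. \<integral>\<^sup>+ y. indicator S (t, y) \<partial>lborel \<partial>lborel) = emeasure lborel S"
    using lborel.nn_integral_fst[OF m2] Sb by (simp add: lborel_prod)
  finally show ?thesis .
qed

lemma hausdorff_distance_le:
  fixes P Q :: "'a::metric_space set"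
  assumes "P \<noteq> {}" "Q \<noteq> {}" "bounded P" "bounded Q"
    and PQ: "\<And>p. p \<in> P \<Longrightarrow> \<exists>q\<in>Q. dist p q \<le> e"
    and QP: "\<And>q. q \<in> Q \<Longrightarrow> \<exists>p\<in>P. dist p q \<le> e"
  shows "0 \<le> hausdorff_distance P Q" "hausdorff_distance P Q \<le> e"
proof -
  have bdd: "bdd_below ((\<lambda>q. dist p q) ` A)" "bdd_below ((\<lambda>q. dist q p) ` A)" for p :: 'a and A
    by (intro bdd_belowI[of _ 0]; force)+
  have 1: "(INF q\<in>Q. dist p q) \<le> e" if p: "p \<in> P" for p
  proof -
    obtain q where q: "q \<in> Q" "dist p q \<le> e" using PQ[OF p] by blast
    have "(INF q\<in>Q. dist p q) \<le> dist p q"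
      by (rule cINF_lower[OF _ q(1)]) (rule bdd)
    then show ?thesis using q(2) by simp
  qed
  have 2: "(INF p\<in>P. dist p q) \<le> e" if p: "q \<in> Q" for q
  proof -
    obtain p where q: "p \<in> P" "dist p q \<le> e" using QP[OF p] by blast
    have "(INF p\<in>P. dist p q) \<le> dist p q"
      by (rule cINF_lower[OF _ q(1)]) (rule bdd)
    then show ?thesis using q(2) by simp
  qed
  have "(SUP p\<in>P. INF q\<in>Q. dist p q) \<le> e" "(SUP q\<in>Q. INF p\<in>P. dist p q) \<le> e"
    using assms(1,2) 1 2 by (auto intro!: cSUP_least)
  then show "hausdorff_distance P Q \<le> e" by (simp add: hausdorff_distance_def)
  obtain p where p: "p \<in> P" using assms(1) by blast
  have "0 \<le> (INF q\<in>Q. dist p q)" using assms(2) by (intro cINF_greatest) auto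
  also have "\<dots> \<le> (SUP p\<in>P. INF q\<in>Q. dist p q)"
    by (rule cSUP_upper[OF p], rule bdd_aboveI[of _ e]) (use 1 in auto)
  finally show "0 \<le> hausdorff_distance P Q" by (simp add: hausdorff_distance_def)
qed

section \<open>The unstable line of the fixed point\<close>

text \<open>For \<nu> = 0 the critical line goes to 1, then to 1 - \<kappa>, and after m steps on
  the left to (c - 1) / (\<kappa> - 1) with c = \<kappa> ^ (m + 1) * (2 - \<kappa>). The bounds on c
  place this between -0.38 and -0.36, left of the leaf near -1/3. The factor 1000 makes all errors
  of order \<nu> negligible against 2 - \<kappa>. All conditions are strict, so they define open
  parameter sets.\<close>

locale lozi_tent =
  fixes \<kappa> \<nu> :: real and m :: nat
  assumes kappa: "(199/100) < \<kappa>" "\<kappa> < 2"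
    and nu: "0 < \<nu>" "1000 * \<nu> < 2 - \<kappa>"
    and return_time: "(63/100) < \<kappa> ^ (m + 1) * (2 - \<kappa>)" "\<kappa> ^ (m + 1) * (2 - \<kappa>) < (16/25)"
begin

definition F :: "real \<times> real \<Rightarrow> real \<times> real" where
  "F = lozi (\<kappa> + \<nu>, - (\<kappa> * \<nu>))"

definition X :: "real \<times> real" where
  "X = lozi_fixed_point (\<kappa> + \<nu>, - (\<kappa> * \<nu>))"

definition W :: "(real \<times> real) set" where
  "W = unstable_manifold F X"

text \<open>Eigenfunctionals, up to constants: \<open>rr\<close> for \<open>- \<kappa>\<close> and \<open>hh\<close> for \<open>- \<nu>\<close> on the right half plane,
  \<open>ll\<close> for \<open>\<kappa>\<close> on the left one.\<close>

definition rr :: "real \<times> real \<Rightarrow> real" where "rr z = fst z - snd z / \<kappa>"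
definition ll :: "real \<times> real \<Rightarrow> real" where "ll z = fst z + snd z / \<kappa>"
definition hh :: "real \<times> real \<Rightarrow> real" where "hh z = snd z - \<nu> * fst z"

lemma nu_small: "\<nu> < (1/100000)"
  using kappa nu by linarith

lemma kappa_nu: "(199/100) * \<nu> \<le> \<kappa> * \<nu>" "\<kappa> * \<nu> \<le> 2 * \<nu>" "0 < \<kappa> * \<nu>"
  using kappa nu by (simp_all add: mult_right_mono)

lemma F_coords [simp]:
  "fst (F z) = 1 + snd z - (\<kappa> + \<nu>) * \<bar>fst z\<bar>" "snd (F z) = - (\<kappa> * \<nu>) * fst z"
  by (simp_all add: F_def lozi_def case_prod_beta)

lemma homeo_F: "homeomorphism UNIV UNIV F (inv F)"
  unfolding F_def by (rule lozi_homeomorphism) (use kappa_nu(3) in linarith)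

lemma bij_F: "bij F"
proof (rule bij_betw_byWitness[where f' = "inv F"])
  show "\<forall>z\<in>UNIV. inv F (F z) = z" "\<forall>z\<in>UNIV. F (inv F z) = z"
    using homeo_F unfolding homeomorphism_def by blast+
qed auto

lemma cont_F: "continuous_on UNIV F" and cont_invF: "continuous_on UNIV (inv F)"
  using homeo_F by (auto simp: homeomorphism_def)

lemma F_inv [simp]: "F (inv F z) = z" and inv_F [simp]: "inv F (F z) = z"
  using homeo_F unfolding homeomorphism_def by blast+

lemma inv_coords:
  "snd z = - (\<kappa> * \<nu>) * fst (inv F z)"
  "fst z = 1 + snd (inv F z) - (\<kappa> + \<nu>) * \<bar>fst (inv F z)\<bar>"
  using F_coords[of "inv F z"] by simp_all

lemma snd_pos_iff: "0 < snd z \<longleftrightarrow> fst (inv F z) < 0"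
  and snd_neg_iff: "snd z < 0 \<longleftrightarrow> 0 < fst (inv F z)"
  using kappa_nu(3) unfolding inv_coords(1)[of z] by (auto simp: zero_less_mult_iff mult_less_0_iff)

lemma rr_F: "0 \<le> fst z \<Longrightarrow> rr (F z) = 1 - \<kappa> * rr z"
  and hh_F: "0 \<le> fst z \<Longrightarrow> hh (F z) = - \<nu> * (1 + hh z)"
  and ll_F: "fst z \<le> 0 \<Longrightarrow> ll (F z) = 1 + \<kappa> * ll z"
  using kappa by (simp_all add: rr_def ll_def hh_def field_simps)

lemma rr_inv: "0 \<le> fst (inv F z) \<Longrightarrow> rr z = 1 - \<kappa> * rr (inv F z)"
  and hh_inv: "0 \<le> fst (inv F z) \<Longrightarrow> hh z = - \<nu> * (1 + hh (inv F z))"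
  and ll_inv: "fst (inv F z) \<le> 0 \<Longrightarrow> ll z = 1 + \<kappa> * ll (inv F z)"
  using rr_F[of "inv F z"] hh_F[of "inv F z"] ll_F[of "inv F z"] by simp_all

text \<open>Here \<open>lY\<close> is the value of \<open>ll\<close> at the other fixed point, which lies to the left of \<open>G\<close>.\<close>

definition rX :: real where "rX = 1 / (1 + \<kappa>)"
definition hX :: real where "hX = - \<nu> / (1 + \<nu>)"
definition lY :: real where "lY = - 1 / (\<kappa> - 1)"

lemma rX_eq: "rX = 1 - \<kappa> * rX" and hX_eq: "hX = - \<nu> * (1 + hX)" and lY_eq: "lY = 1 + \<kappa> * lY"
proof -
  have "1 + \<kappa> \<noteq> 0" "1 + \<nu> \<noteq> 0" "\<kappa> - 1 \<noteq> 0" using kappa nu by linarith+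
  then show "rX = 1 - \<kappa> * rX" "hX = - \<nu> * (1 + hX)" "lY = 1 + \<kappa> * lY"
    by (simp_all add: rX_def hX_def lY_def field_simps)
qed

lemma rX_bounds: "(333/1000) < rX" "rX < (67/200)"
  using kappa by (simp_all add: rX_def field_simps)

lemma hX_bounds: "-\<nu> < hX" "hX < - (99/100) * \<nu>"
  using nu nu_small by (simp_all add: hX_def field_simps)

lemma lY_bounds: "-(1011/1000) < lY" "lY < -1"
  using kappa by (simp_all add: lY_def field_simps)

lemma X_fixed: "F X = X"
  unfolding F_def X_def by (rule lozi_fixed_point) (use kappa kappa_nu nu in linarith)

lemma X_coords: "fst X > (3/10)" "fst X < (2/5)" "rr X = rX" "hh X = hX"
proof -
  have d: "3 - (1/100) < 1 + (\<kappa> + \<nu>) + \<kappa> * \<nu>" "1 + (\<kappa> + \<nu>) + \<kappa> * \<nu> < (31/10)"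
    using kappa kappa_nu nu nu_small by linarith+
  show 1: "fst X > (3/10)" and "fst X < (2/5)"
    using d by (simp_all add: X_def lozi_fixed_point_def field_simps)
  have "rr X = 1 - \<kappa> * rr X" using rr_F[of X] 1 X_fixed by simp
  then show "rr X = rX" using kappa by (simp add: rX_def field_simps)
  have "hh X = - \<nu> * (1 + hh X)" using hh_F[of X] 1 X_fixed by simp
  then show "hh X = hX" using nu by (simp add: hX_def field_simps)
qed

lemma fst_of_rr_hh: "fst z * (1 - \<nu> / \<kappa>) = rr z + hh z / \<kappa>"
  using kappa by (simp add: rr_def hh_def field_simps)

text \<open>\<open>rr\<close> and \<open>hh\<close> are affine coordinates with X at
  (\<open>rX\<close>, \<open>hX\<close>); the bound turns geometric rates for them into convergence
  to X.\<close>

lemma dist_X_le: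
  "dist z X \<le> 4 * (\<bar>rr z - rX\<bar> + \<bar>hh z - hX\<bar>)"
proof -
  let ?r = "rr z - rX" and ?h = "hh z - hX"
  have q: "1/2 \<le> 1 - \<nu> / \<kappa>" using kappa nu nu_small by (simp add: field_simps)
  have "(fst z - fst X) * (1 - \<nu> / \<kappa>) = ?r + ?h / \<kappa>"
    using fst_of_rr_hh[of z] fst_of_rr_hh[of X] X_coords(3,4) by (simp add: algebra_simps diff_divide_distrib)
  then have "\<bar>fst z - fst X\<bar> * (1 - \<nu> / \<kappa>) = \<bar>?r + ?h / \<kappa>\<bar>"
    using q by (metis abs_mult abs_of_nonneg order_trans zero_le_divide_1_iff zero_le_numeral)
  moreover have "\<bar>fst z - fst X\<bar> * (1/2) \<le> \<bar>fst z - fst X\<bar> * (1 - \<nu> / \<kappa>)"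
    using q by (intro mult_left_mono) auto
  moreover have "\<bar>?r + ?h / \<kappa>\<bar> \<le> \<bar>?r\<bar> + \<bar>?h / \<kappa>\<bar>" by linarith
  moreover have "\<bar>?h / \<kappa>\<bar> \<le> \<bar>?h\<bar> / 1"
  proof -
    have "\<bar>?h\<bar> / \<kappa> \<le> \<bar>?h\<bar> / 1" using kappa by (intro divide_left_mono) auto
    then show ?thesis using kappa by (simp add: abs_divide)
  qed
  ultimately have x: "\<bar>fst z - fst X\<bar> \<le> 2 * \<bar>?r\<bar> + 2 * \<bar>?h\<bar>" by linarith
  have "snd z - snd X = ?h + \<nu> * (fst z - fst X)"
    using X_coords(4) by (simp add: hh_def algebra_simps)
  then have "\<bar>snd z - snd X\<bar> \<le> \<bar>?h\<bar> + \<bar>\<nu> * (fst z - fst X)\<bar>" by linarith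
  moreover have "\<bar>\<nu> * (fst z - fst X)\<bar> \<le> (1/2) * \<bar>fst z - fst X\<bar>"
    unfolding abs_mult using nu nu_small by (intro mult_right_mono) auto
  ultimately have y: "\<bar>snd z - snd X\<bar> \<le> \<bar>?h\<bar> + (1/2) * \<bar>fst z - fst X\<bar>" by linarith
  have "dist z X \<le> \<bar>fst z - fst X\<bar> + \<bar>snd z - snd X\<bar>"
    using sqrt_sum_squares_le_sum_abs by (simp add: dist_prod_def dist_real_def)
  moreover have "d \<le> 4 * (A + B)"
    if "d \<le> p + q" "p \<le> 2 * A + 2 * B" "q \<le> B + (1/2) * p" "0 \<le> A" "0 \<le> B" for d p q A B :: real
    using that by argo
  ultimately show ?thesis using x y abs_ge_zero[of ?r] abs_ge_zero[of ?h] by blast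
qed

lemma W_iff: "z \<in> W \<longleftrightarrow> (\<lambda>n. (inv F ^^ n) z) \<longlonglongrightarrow> X"
  unfolding W_def using unstable_manifold_fixed_point[OF bij_F X_fixed] by simp

lemma W_F_iff: "F z \<in> W \<longleftrightarrow> z \<in> W"
  unfolding W_def using unstable_manifold_image_iff[OF bij_F X_fixed, of 1] by simp

lemma W_inv_iff: "inv F z \<in> W \<longleftrightarrow> z \<in> W"
  using W_F_iff[of "inv F z"] by simp

lemma W_inv_pow_iff: "(inv F ^^ n) z \<in> W \<longleftrightarrow> z \<in> W"
  by (induction n) (simp_all add: W_inv_iff)

lemma X_in_W: "X \<in> W"
proof -
  have "inv F X = X" using X_fixed inv_F by metis
  then have "(inv F ^^ n) X = X" for n by (induction n) auto
  then show ?thesis by (simp add: W_iff)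
qed

text \<open>On the right half plane the inverse expands \<open>hh\<close> by the factor \<open>1 / \<nu>\<close>, so a bounded
  backward orbit staying there lies on the unstable line of the fixed point.\<close>

lemma backward_right_eq:
  assumes "\<And>i. i < n \<Longrightarrow> 0 \<le> fst ((inv F ^^ Suc i) z)"
  shows "rr ((inv F ^^ n) z) - rX = (rr z - rX) / (- \<kappa>) ^ n"
    and "hh z - hX = (- \<nu>) ^ n * (hh ((inv F ^^ n) z) - hX)"
proof -
  have "rr ((inv F ^^ n) z) - rX = (rr z - rX) / (- \<kappa>) ^ n
      \<and> hh z - hX = (- \<nu>) ^ n * (hh ((inv F ^^ n) z) - hX)"
    using assms
  proof (induction n)
    case (Suc n)
    let ?w = "(inv F ^^ n) z"
    have pos: "0 \<le> fst (inv F ?w)" using Suc.prems[of n] by simp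
    have "rr ?w - rX = - \<kappa> * (rr (inv F ?w) - rX)"
      using rr_inv[OF pos] rX_eq by (simp add: algebra_simps)
    moreover have "hh ?w - hX = - \<nu> * (hh (inv F ?w) - hX)"
      using hh_inv[OF pos] hX_eq by (simp add: algebra_simps)
    moreover have "rr ?w - rX = (rr z - rX) / (- \<kappa>) ^ n" "hh z - hX = (- \<nu>) ^ n * (hh ?w - hX)"
      using Suc by auto
    ultimately have "- \<kappa> * (rr (inv F ?w) - rX) = (rr z - rX) / (- \<kappa>) ^ n"
      and "hh z - hX = (- \<nu>) ^ n * (- \<nu> * (hh (inv F ?w) - hX))"
      by simp_all
    moreover have "x / - \<kappa> = y" if "- \<kappa> * y = x" for x y
      using that kappa by (simp add: field_simps)
    ultimately have "((rr z - rX) / (- \<kappa>) ^ n) / (- \<kappa>) = rr (inv F ?w) - rX"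
      by blast
    then show ?case using \<open>hh z - hX = (- \<nu>) ^ n * (- \<nu> * (hh (inv F ?w) - hX))\<close>
      by (simp add: mult.commute)
  qed simp
  then show "rr ((inv F ^^ n) z) - rX = (rr z - rX) / (- \<kappa>) ^ n"
    and "hh z - hX = (- \<nu>) ^ n * (hh ((inv F ^^ n) z) - hX)" by auto
qed

text \<open>On the line \<open>hh\<close> = \<open>hX\<close> only \<open>rr\<close> varies, and
  each backward step divides its distance to \<open>rX\<close> by \<kappa>.\<close>

lemma backward_right_W:
  assumes pos: "\<And>i. 0 \<le> fst ((inv F ^^ Suc i) z)" and hz: "hh z = hX"
  shows "z \<in> W"
proof -
  have r: "rr ((inv F ^^ n) z) - rX = (rr z - rX) / (- \<kappa>) ^ n" for n
    using backward_right_eq(1)[of n z] pos by blast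
  have h: "hh ((inv F ^^ n) z) - hX = 0" for n
    using backward_right_eq(2)[of n z] pos hz nu by simp
  have d: "dist ((inv F ^^ n) z) X \<le> 4 * \<bar>rr z - rX\<bar> * (1 / \<kappa>) ^ n" for n
    using dist_X_le[of "(inv F ^^ n) z"] kappa unfolding r h
    by (simp add: abs_divide power_abs power_divide)
  have "(\<lambda>n. 4 * \<bar>rr z - rX\<bar> * (1 / \<kappa>) ^ n) \<longlonglongrightarrow> 0"
    using kappa by (intro tendsto_mult_right_zero LIMSEQ_realpow_zero) auto
  then have "(\<lambda>n. dist ((inv F ^^ n) z) X) \<longlonglongrightarrow> 0"
    by (rule Lim_null_comparison[rotated]) (use d in simp)
  then show ?thesis
    unfolding W_iff tendsto_dist_iff[of "\<lambda>n. (inv F ^^ n) z"] .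
qed

lemma backward_right_hh:
  assumes pos: "\<And>i. 0 \<le> fst ((inv F ^^ Suc i) z)"
    and bd: "\<And>i. \<bar>hh ((inv F ^^ i) z) - hX\<bar> \<le> C"
  shows "hh z = hX"
proof -
  have "\<bar>hh z - hX\<bar> \<le> C * \<nu> ^ n" for n
  proof -
    have "\<bar>hh z - hX\<bar> = \<nu> ^ n * \<bar>hh ((inv F ^^ n) z) - hX\<bar>"
      using backward_right_eq(2)[of n z] pos nu by (simp add: abs_mult power_abs)
    also have "\<dots> \<le> \<nu> ^ n * C" using bd nu by (intro mult_left_mono) auto
    finally show ?thesis by (simp add: mult.commute)
  qed
  moreover have "(\<lambda>n. C * \<nu> ^ n) \<longlonglongrightarrow> 0"
    using nu nu_small by (intro tendsto_mult_right_zero LIMSEQ_realpow_zero) auto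
  ultimately have "\<bar>hh z - hX\<bar> \<le> 0"
    by (intro LIMSEQ_le_const[of "\<lambda>n. C * \<nu> ^ n"]) auto
  then show ?thesis by simp
qed

text \<open>The segment is invariant under the inverse, which acts on it by r \<mapsto> (1 - r) /
  \<kappa>. Its end at 19/20 keeps it below the axis, its other end lets it cover the
  window.\<close>

lemma unstable_line_in_W:
  assumes "hh z = hX" "-(9/20) < rr z" "rr z < (19/20)"
  shows "z \<in> W"
proof -
  have step: "0 < fst (inv F z) \<and> hh (inv F z) = hX \<and> -(9/20) < rr (inv F z) \<and> rr (inv F z) < (19/20)"
    if h: "hh z = hX" "-(9/20) < rr z" "rr z < (19/20)" for z
  proof -
    have q: "(99/100) < 1 - \<nu> / \<kappa>" "1 - \<nu> / \<kappa> \<le> 1" using kappa nu nu_small by (simp_all add: field_simps)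
    have "hX / \<kappa> < 0" using hX_bounds kappa nu by (simp add: divide_neg_pos)
    then have "fst z * (1 - \<nu> / \<kappa>) < (19/20)" using fst_of_rr_hh[of z] h(3) unfolding h(1) by linarith
    moreover have "fst z * (99/100) \<le> fst z * (1 - \<nu> / \<kappa>)" if "fst z \<ge> 0"
      using q that by (intro mult_left_mono) auto
    ultimately have "fst z < (97/100)" by (cases "fst z \<ge> 0") linarith+
    then have "\<nu> * fst z \<le> \<nu> * (97/100)" using nu by (intro mult_left_mono) auto
    \<comment> \<open>The line meets the axis only near x = 1, so up to x = 97/100 its points lie
      below the axis and have preimages on the right.\<close>
    then have "snd z < 0" using h(1) hX_bounds nu unfolding hh_def by linarith
    then have p: "0 < fst (inv F z)" by (simp add: snd_neg_iff)
    have "hX = - \<nu> * (1 + hh (inv F z))" using hh_inv[of z] p h by simp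
    then have "hh (inv F z) = hX" using hX_eq nu by (metis add_left_cancel less_numeral_extra(3) mult_left_cancel neg_equal_0_iff_equal)
    moreover have "rr z = 1 - \<kappa> * rr (inv F z)" using rr_inv[of z] p by simp
    then have e: "\<kappa> * rr (inv F z) = 1 - rr z" by simp
    have "0 < \<kappa> * rr (inv F z)" using e h(3) by linarith
    then have "0 < rr (inv F z)" using kappa by (simp add: zero_less_mult_iff)
    moreover have "rr (inv F z) < (19/20)"
    proof (rule ccontr)
      assume "\<not> rr (inv F z) < (19/20)"
      then have "(199/100) * (19/20) \<le> \<kappa> * rr (inv F z)" using kappa by (intro mult_mono) auto
      then show False using e h(2) by linarith
    qed
    ultimately show ?thesis using p by auto
  qed
  have all: "hh ((inv F ^^ n) z) = hX \<and> -(9/20) < rr ((inv F ^^ n) z) \<and> rr ((inv F ^^ n) z) < (19/20)" for n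
    by (induction n) (use assms step in auto)
  have "0 \<le> fst ((inv F ^^ Suc i) z)" for i
    using step[of "(inv F ^^ i) z"] all[of i] by auto
  then show ?thesis using backward_right_W assms(1) by blast
qed

section \<open>Straight pieces of the unstable manifold over the window\<close>

text \<open>A pair \<open>(s, c)\<close> stands for the line \<open>y = s x + c\<close>, whose images under the right and the left
  branch are \<open>LR (s, c)\<close> and \<open>LL (s, c)\<close>.\<close>

definition LR :: "real \<times> real \<Rightarrow> real \<times> real" where
  "LR \<sigma> = (let t = \<kappa> * \<nu> / (\<kappa> + \<nu> - fst \<sigma>) in (t, - t * (1 + snd \<sigma>)))"
definition LL :: "real \<times> real \<Rightarrow> real \<times> real" where
  "LL \<sigma> = (let t = \<kappa> * \<nu> / (\<kappa> + \<nu> + fst \<sigma>) in (- t, t * (1 + snd \<sigma>)))"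
definition DL :: "real \<times> real \<Rightarrow> real \<times> real \<Rightarrow> real" where
  "DL \<sigma> z = snd z - fst \<sigma> * fst z - snd \<sigma>"
text \<open>A class of lines invariant under both branches: images have slope and intercept within
  one percent of \<nu> in absolute value, so the factor 2 leaves room.\<close>

definition flat :: "real \<times> real \<Rightarrow> bool" where
  "flat \<sigma> \<longleftrightarrow> \<bar>fst \<sigma>\<bar> \<le> 2 * \<nu> \<and> \<bar>snd \<sigma>\<bar> \<le> 2 * \<nu>"

text \<open>The denominator differs from \<kappa> by at most 3\<nu>, so one application of a branch
  resets the slope to nearly \<nu>, whatever flat line was given. The sign of s selects the
  branch.\<close>

lemma slope_bounds:
  assumes "\<bar>s\<bar> \<le> 2 * \<nu>" "\<bar>c\<bar> \<le> 2 * \<nu>"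
  defines "t \<equiv> \<kappa> * \<nu> / (\<kappa> + \<nu> + s)"
  shows "(99/100) * \<nu> \<le> t" "t \<le> (101/100) * \<nu>" "(99/100) * \<nu> \<le> t * (1 + c)" "t * (1 + c) \<le> (101/100) * \<nu>"
proof -
  have d: "0 < \<kappa> + \<nu> + s" using assms(1) kappa nu by linarith
  have "(199/200) * (\<kappa> + \<nu> + s) \<le> \<kappa>" "\<kappa> \<le> (201/200) * (\<kappa> + \<nu> + s)"
    unfolding distrib_left using assms(1) kappa nu nu_small by linarith+
  then have "\<nu> * ((199/200) * (\<kappa> + \<nu> + s)) \<le> \<nu> * \<kappa>" "\<nu> * \<kappa> \<le> \<nu> * ((201/200) * (\<kappa> + \<nu> + s))"
    using nu by (auto intro!: mult_left_mono)
  then have t: "(199/200) * \<nu> \<le> t" "t \<le> (201/200) * \<nu>"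
    unfolding t_def using d by (simp_all add: le_divide_eq divide_le_eq mult_ac)
  have c: "\<bar>c\<bar> \<le> (1/1000)" using assms(2) nu_small by linarith
  have "\<bar>t * c\<bar> \<le> ((201/200) * \<nu>) * (1/1000)"
    unfolding abs_mult using t c nu by (intro mult_mono) auto
  then have "\<bar>t * c\<bar> \<le> (1/500) * \<nu>" using nu by linarith
  with t nu show "(99/100) * \<nu> \<le> t" "t \<le> (101/100) * \<nu>" "(99/100) * \<nu> \<le> t * (1 + c)" "t * (1 + c) \<le> (101/100) * \<nu>"
    unfolding distrib_left by linarith+
qed

lemma LR_bounds:
  assumes "flat \<sigma>"
  shows "(99/100) * \<nu> \<le> fst (LR \<sigma>)" "fst (LR \<sigma>) \<le> (101/100) * \<nu>"
    "- (101/100) * \<nu> \<le> snd (LR \<sigma>)" "snd (LR \<sigma>) \<le> - (99/100) * \<nu>"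
  using slope_bounds[of "- fst \<sigma>" "snd \<sigma>"] assms by (auto simp: flat_def LR_def Let_def)

lemma LL_bounds:
  assumes "flat \<sigma>"
  shows "- (101/100) * \<nu> \<le> fst (LL \<sigma>)" "fst (LL \<sigma>) \<le> - (99/100) * \<nu>"
    "(99/100) * \<nu> \<le> snd (LL \<sigma>)" "snd (LL \<sigma>) \<le> (101/100) * \<nu>"
  using slope_bounds[of "fst \<sigma>" "snd \<sigma>"] assms by (auto simp: flat_def LL_def Let_def)

lemma flat_LR: "flat \<sigma> \<Longrightarrow> flat (LR \<sigma>)" and flat_LL: "flat \<sigma> \<Longrightarrow> flat (LL \<sigma>)"
  using LR_bounds[of \<sigma>] LL_bounds[of \<sigma>] nu unfolding flat_def[of "LR \<sigma>"] flat_def[of "LL \<sigma>"]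
  by linarith+

lemma flat_LL_pow: "flat \<sigma> \<Longrightarrow> flat ((LL ^^ n) \<sigma>)"
  by (induction n) (auto simp: flat_LL)

text \<open>Points on the wrong side of the critical line \<open>x = 0\<close> are folded below the image line.\<close>

lemma fold_aux:
  fixes k t A s c c' x y :: real
  shows "k = t * (A - s) \<Longrightarrow> c' = - t * (1 + c) \<Longrightarrow>
      - k * x - t * (1 + y - A * x) - c' = - t * (y - s * x - c - 2 * A * 0)"
    and "k = t * (A - s) \<Longrightarrow> c' = - t * (1 + c) \<Longrightarrow>
      - k * x - t * (1 + y - A * - x) - c' = - t * (y - s * x - c - 2 * A * - x)"
    and "k = - t * (A + s) \<Longrightarrow> c' = - t * (1 + c) \<Longrightarrow>
      - k * x - t * (1 + y - A * x) - c' = - t * (y - s * x - c - 2 * A * x)"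
    and "k = - t * (A + s) \<Longrightarrow> c' = - t * (1 + c) \<Longrightarrow>
      - k * x - t * (1 + y - A * - x) - c' = - t * (y - s * x - c - 2 * A * 0)"
  by (hypsubst, simp add: algebra_simps)+

text \<open>For a point on the left, F agrees with the affine right branch applied to the point
  lowered by 2 (\<kappa> + \<nu>) |x|. The affine branch multiplies the height over the line by
  minus the slope of the image line, hence reverses above and below.\<close>

lemma DL_LR:
  assumes "flat \<sigma>"
  shows "DL (LR \<sigma>) (F w) = - fst (LR \<sigma>) * (DL \<sigma> w - 2 * (\<kappa> + \<nu>) * max 0 (- fst w))"
proof -
  have "\<kappa> + \<nu> - fst \<sigma> \<noteq> 0" using assms kappa nu unfolding flat_def by linarith
  then have h: "\<kappa> * \<nu> = fst (LR \<sigma>) * (\<kappa> + \<nu> - fst \<sigma>)" by (simp add: LR_def Let_def)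
  have h2: "snd (LR \<sigma>) = - fst (LR \<sigma>) * (1 + snd \<sigma>)" by (simp add: LR_def Let_def)
  show ?thesis
  proof (cases "0 \<le> fst w")
    case True
    then have e: "\<bar>fst w\<bar> = fst w" "max 0 (- fst w) = 0" by auto
    show ?thesis unfolding DL_def F_coords e using h h2 by (rule fold_aux)
  next
    case False
    then have e: "\<bar>fst w\<bar> = - fst w" "max 0 (- fst w) = - fst w" by auto
    show ?thesis unfolding DL_def F_coords e using h h2 by (rule fold_aux)
  qed
qed

lemma DL_LL:
  assumes "flat \<sigma>"
  shows "DL (LL \<sigma>) (F w) = - fst (LL \<sigma>) * (DL \<sigma> w - 2 * (\<kappa> + \<nu>) * max 0 (fst w))"
proof -
  have "\<kappa> + \<nu> + fst \<sigma> \<noteq> 0" using assms kappa nu unfolding flat_def by linarith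
  then have h: "\<kappa> * \<nu> = - fst (LL \<sigma>) * (\<kappa> + \<nu> + fst \<sigma>)" by (simp add: LL_def Let_def)
  have h2: "snd (LL \<sigma>) = - fst (LL \<sigma>) * (1 + snd \<sigma>)" by (simp add: LL_def Let_def)
  show ?thesis
  proof (cases "0 \<le> fst w")
    case True
    then have e: "\<bar>fst w\<bar> = fst w" "max 0 (fst w) = fst w" by auto
    show ?thesis unfolding DL_def F_coords e using h h2 by (rule fold_aux)
  next
    case False
    then have e: "\<bar>fst w\<bar> = - fst w" "max 0 (fst w) = 0" by auto
    show ?thesis unfolding DL_def F_coords e using h h2 by (rule fold_aux)
  qed
qed

lemma DL_LR_inv:
  "flat \<sigma> \<Longrightarrow> DL (LR \<sigma>) z = - fst (LR \<sigma>) * (DL \<sigma> (inv F z) - 2 * (\<kappa> + \<nu>) * max 0 (- fst (inv F z)))"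
  and DL_LL_inv:
  "flat \<sigma> \<Longrightarrow> DL (LL \<sigma>) z = - fst (LL \<sigma>) * (DL \<sigma> (inv F z) - 2 * (\<kappa> + \<nu>) * max 0 (fst (inv F z)))"
  using DL_LR[of \<sigma> "inv F z"] DL_LL[of \<sigma> "inv F z"] by simp_all

lemma ll_coords: "ll z = 1 + snd (inv F z) - (\<kappa> + \<nu>) * \<bar>fst (inv F z)\<bar> - \<nu> * fst (inv F z)"
  using inv_coords[of z] kappa by (simp add: ll_def)

text \<open>A preimage on the right would put z on or below the axis. The image line is above the
  axis until x is about 1, so z, being on or above that line, would have x > 49/50 and
  \<open>ll\<close> too large.\<close>

lemma left_step:
  assumes "flat \<sigma>" "ll z \<le> (1/5)" "0 \<le> DL (LL \<sigma>) z"
  shows "fst (inv F z) < 0" "ll z = 1 + \<kappa> * ll (inv F z)"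
    "DL (LL \<sigma>) z = - fst (LL \<sigma>) * DL \<sigma> (inv F z)"
proof -
  note b = LL_bounds[OF assms(1)]
  show "fst (inv F z) < 0"
  proof (rule ccontr)
    assume "\<not> fst (inv F z) < 0"
    then have y: "snd z \<le> 0" using snd_pos_iff by (meson not_le)
    have D: "fst (LL \<sigma>) * fst z + snd (LL \<sigma>) \<le> snd z" using assms(3) by (simp add: DL_def)
    have x0: "0 < fst z"
    proof (rule ccontr)
      assume "\<not> 0 < fst z"
      then have "0 \<le> fst (LL \<sigma>) * fst z" using b nu by (intro mult_nonpos_nonpos) auto
      then show False using D y b nu by linarith
    qed
    have 1: "- (101/100) * \<nu> * fst z \<le> fst (LL \<sigma>) * fst z"
      using x0 b by (intro mult_right_mono) auto
    have "\<nu> * (49/50) < \<nu> * fst z" using 1 D y b nu by linarith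
    then have x: "(49/50) < fst z" using nu by (simp add: mult_less_cancel_left)
    have "\<nu> * fst z \<le> (1/100000) * fst z" using nu_small x0 by (intro mult_right_mono) auto
    then have "- (1/10) * fst z \<le> snd z" using 1 D b nu x0 by linarith
    moreover have "snd z / 1 \<le> snd z / \<kappa>" using y kappa by (intro divide_left_mono_neg) auto
    ultimately have "(9/10) * fst z \<le> ll z" unfolding ll_def div_by_1 by linarith
    then show False using x assms(2) by linarith
  qed
  then show "ll z = 1 + \<kappa> * ll (inv F z)"
    "DL (LL \<sigma>) z = - fst (LL \<sigma>) * DL \<sigma> (inv F z)"
    using ll_inv[of z] DL_LL_inv[OF assms(1), of z] by simp_all
qed

text \<open>The hypotheses of \<open>left_step\<close> persist backwards: the preimage is again on
  or above its line, and \<open>ll\<close> > 1/5 there would make \<open>ll z\<close> exceed 1. Of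
  the accumulated factor only the sign and the bound 1 matter.\<close>

lemma left_chain:
  assumes "flat \<sigma>" "ll z \<le> (1/5)" "0 \<le> DL ((LL ^^ n) \<sigma>) z"
  shows "ll ((inv F ^^ n) z) - lY = (ll z - lY) / \<kappa> ^ n"
    "\<exists>C. 0 < C \<and> C \<le> 1 \<and> DL ((LL ^^ n) \<sigma>) z = C * DL \<sigma> ((inv F ^^ n) z)"
proof -
  have "ll ((inv F ^^ n) z) - lY = (ll z - lY) / \<kappa> ^ n \<and>
    (\<exists>C. 0 < C \<and> C \<le> 1 \<and> DL ((LL ^^ n) \<sigma>) z = C * DL \<sigma> ((inv F ^^ n) z))"
    using assms(2,3)
  proof (induction n arbitrary: z)
    case 0
    then show ?case by (auto intro: exI[of _ 1])
  next
    case (Suc n)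
    let ?\<tau> = "(LL ^^ n) \<sigma>" and ?w = "inv F z"
    have fl: "flat ?\<tau>" by (rule flat_LL_pow[OF assms(1)])
    note b = LL_bounds[OF fl]
    have D: "0 \<le> DL (LL ?\<tau>) z" using Suc.prems by simp
    note st = left_step[OF fl Suc.prems(1) D]
    have ll: "\<kappa> * (ll ?w - lY) = ll z - lY"
      using st(2) lY_eq by (simp add: algebra_simps)
    have "ll ?w \<le> (1/5)"
    proof (rule ccontr)
      assume "\<not> ll ?w \<le> (1/5)"
      then have "0 \<le> \<kappa> * ll ?w" using kappa by simp
      then show False using st(2) Suc.prems(1) by linarith
    qed
    moreover have "0 \<le> DL ?\<tau> ?w" using D b nu unfolding st(3) by (simp add: mult_le_0_iff)
    ultimately obtain C where C: "ll ((inv F ^^ n) ?w) - lY = (ll ?w - lY) / \<kappa> ^ n"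
      "0 < C" "C \<le> 1" "DL ?\<tau> ?w = C * DL \<sigma> ((inv F ^^ n) ?w)"
      using Suc.IH by blast
    have sw: "(inv F ^^ n) ?w = (inv F ^^ Suc n) z" by (simp add: funpow_swap1)
    have "ll ?w - lY = (ll z - lY) / \<kappa>" using ll kappa by (simp add: field_simps)
    then have "ll ((inv F ^^ Suc n) z) - lY = (ll z - lY) / \<kappa> ^ Suc n"
      using C(1) unfolding sw by simp
    moreover have "DL ((LL ^^ Suc n) \<sigma>) z = (- fst (LL ?\<tau>) * C) * DL \<sigma> ((inv F ^^ Suc n) z)"
      using st(3) C(4) unfolding sw by simp
    moreover have "0 < - fst (LL ?\<tau>) * C" using b nu C(2) by (intro mult_pos_pos) auto
    moreover have "- fst (LL ?\<tau>) * C \<le> 1" using b nu nu_small C(2,3) by (intro mult_le_one) auto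
    ultimately show ?case by blast
  qed
  then show "ll ((inv F ^^ n) z) - lY = (ll z - lY) / \<kappa> ^ n"
    "\<exists>C. 0 < C \<and> C \<le> 1 \<and> DL ((LL ^^ n) \<sigma>) z = C * DL \<sigma> ((inv F ^^ n) z)" by auto
qed

section \<open>The return map along the itinerary right, right, m times left\<close>

definition \<Phi> :: "real \<times> real \<Rightarrow> real \<times> real" where
  "\<Phi> \<sigma> = (LL ^^ m) (LR (LR \<sigma>))"

lemma flat_\<Phi>: "flat \<sigma> \<Longrightarrow> flat (\<Phi> \<sigma>)"
  unfolding \<Phi>_def by (intro flat_LL_pow flat_LR)

lemma power_return:
  "0 < \<kappa> ^ m" "1 / \<kappa> ^ m < \<kappa> * (2 - \<kappa>) / (63/100)" "\<kappa> * (2 - \<kappa>) / (16/25) < 1 / \<kappa> ^ m"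
proof -
  show p: "0 < \<kappa> ^ m" using kappa by simp
  show "1 / \<kappa> ^ m < \<kappa> * (2 - \<kappa>) / (63/100)" "\<kappa> * (2 - \<kappa>) / (16/25) < 1 / \<kappa> ^ m"
  proof -
    define q where "q = \<kappa> * (2 - \<kappa>)"
    have "(63/100) < q * \<kappa> ^ m" "q * \<kappa> ^ m < (16/25)"
      using return_time by (simp_all add: q_def mult_ac)
    then have "1 / \<kappa> ^ m < q / (63/100)" "q / (16/25) < 1 / \<kappa> ^ m"
      using p by (simp_all add: divide_simps)
    then show "1 / \<kappa> ^ m < \<kappa> * (2 - \<kappa>) / (63/100)" "\<kappa> * (2 - \<kappa>) / (16/25) < 1 / \<kappa> ^ m"
      by (simp_all add: q_def)
  qed
qed

text \<open>Here lY + e is the value of \<open>ll\<close> after m backward steps on the left from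
  the window. The first bound says that the tip of the fold has not been reached; the last one says
  that one more step on the left would leave G, by \<open>G_bounds\<close>.\<close>

lemma return_estimate:
  assumes "-(341/1000) \<le> u" "u \<le> (1/5)"
  defines "e \<equiv> (u - lY) / \<kappa> ^ m"
  shows "1 - \<kappa> + 3 * \<nu> < lY + e" "lY + e < -(24/25)"
    "u \<le> (181/1000) \<Longrightarrow> e / \<kappa> < (19/10) * (2 - \<kappa>)"
proof -
  have e: "e = (u - lY) * (1 / \<kappa> ^ m)" by (simp add: e_def)
  have kd: "0 < \<kappa> * (2 - \<kappa>)" using kappa by simp
  have "lY * (\<kappa> - 1) = -1" using kappa by (simp add: lY_def)
  then have id: "1 - \<kappa> - lY = - lY * (\<kappa> * (2 - \<kappa>))" by algebra
  have "(u - lY) * (\<kappa> * (2 - \<kappa>) / (16/25)) \<le> e"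
    unfolding e using power_return assms(1,2) lY_bounds by (intro mult_left_mono) auto
  moreover have "(-(341/1000) - lY) * (\<kappa> * (2 - \<kappa>) / (16/25)) \<le> (u - lY) * (\<kappa> * (2 - \<kappa>) / (16/25))"
    using assms(1) kd by (intro mult_right_mono) auto
  \<comment> \<open>Since -lY > 1, the distance from the window to lY exceeds (16/25)(-lY) by more
    than (16/25)/200. This surplus, of order (2 - \<kappa>)/100, absorbs the 3\<nu>.\<close>
  moreover have "((16/25) * (- lY) + (16/25) * (1/200)) * (\<kappa> * (2 - \<kappa>) / (16/25)) \<le> (-(341/1000) - lY) * (\<kappa> * (2 - \<kappa>) / (16/25))"
    using kd lY_bounds by (intro mult_right_mono) auto
  moreover have "((16/25) * (- lY) + (16/25) * (1/200)) * (\<kappa> * (2 - \<kappa>) / (16/25)) = - lY * (\<kappa> * (2 - \<kappa>)) + (1/200) * (\<kappa> * (2 - \<kappa>))"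
    by (simp add: field_simps)
  moreover have "(199/100) * (2 - \<kappa>) \<le> \<kappa> * (2 - \<kappa>)" using kappa by (intro mult_right_mono) auto
  ultimately show "1 - \<kappa> + 3 * \<nu> < lY + e" using id nu by argo
  have "\<kappa> * (2 - \<kappa>) \<le> 2 * (1/100)" using kappa by (intro mult_mono) auto
  then have "\<kappa> * (2 - \<kappa>) / (63/100) \<le> (4/125)" by simp
  then have "1 / \<kappa> ^ m \<le> (4/125)" using power_return by linarith
  then have "e \<le> (61/50) * (4/125)"
    unfolding e using power_return assms(1,2) lY_bounds by (intro mult_mono) auto
  then show "lY + e < -(24/25)" using lY_bounds by linarith
  show "e / \<kappa> < (19/10) * (2 - \<kappa>)" if "u \<le> (181/1000)"
  proof -
    have "e \<le> (149/125) * (\<kappa> * (2 - \<kappa>) / (63/100))"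
      unfolding e using power_return that assms(1) lY_bounds kd by (intro mult_mono) auto
    then have "e / \<kappa> \<le> (149/125) * (\<kappa> * (2 - \<kappa>) / (63/100)) / \<kappa>"
      using kappa by (intro divide_right_mono) auto
    also have "\<dots> = (149/125) / (63/100) * (2 - \<kappa>)" using kappa by (simp add: field_simps)
    also have "\<dots> < (19/10) * (2 - \<kappa>)" using kappa by (intro mult_strict_right_mono) auto
    finally show ?thesis .
  qed
qed

lemma product_bounds:
  "\<nu> * \<bar>x\<bar> \<le> (1/100000) * \<bar>x\<bar>" "(199/100) * \<bar>x\<bar> \<le> \<kappa> * \<bar>x\<bar>" "\<kappa> * \<bar>x\<bar> \<le> 2 * \<bar>x\<bar>" "0 \<le> \<nu> * \<bar>x\<bar>"
  using kappa nu nu_small by (intro mult_right_mono mult_nonneg_nonneg; linarith)+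

lemma flat_abs_le:
  assumes "flat \<sigma>"
  shows "\<bar>fst \<sigma> * x\<bar> \<le> 2 * (\<nu> * \<bar>x\<bar>)"
proof -
  have "\<bar>fst \<sigma>\<bar> * \<bar>x\<bar> \<le> (2 * \<nu>) * \<bar>x\<bar>"
    using assms unfolding flat_def by (intro mult_right_mono) auto
  then show ?thesis by (simp add: abs_mult)
qed

text \<open>Thus the fold never cuts the image: all of the piece of \<open>\<Phi> \<sigma>\<close>
  over the window comes from a short piece of \<sigma> just right of the critical line.\<close>

lemma return_backward:
  assumes "flat \<sigma>" "DL (\<Phi> \<sigma>) z = 0" "-(341/1000) \<le> ll z" "ll z \<le> (1/5)"
  defines "w \<equiv> (inv F ^^ (m + 2)) z"
  shows "DL \<sigma> w = 0" "0 \<le> fst w" "fst w \<le> (3/50)"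
proof -
  define w1 where "w1 = (inv F ^^ m) z"
  define w2 where "w2 = inv F w1"
  have w: "w = inv F w2" by (simp add: w_def w2_def w1_def)
  have f1: "flat (LR \<sigma>)" and f2: "flat (LR (LR \<sigma>))" using assms(1) flat_LR by auto
  note b1 = LR_bounds[OF f1] and b2 = LR_bounds[OF assms(1)]
  have ch: "ll w1 - lY = (ll z - lY) / \<kappa> ^ m" "DL (LR (LR \<sigma>)) w1 = 0"
    using left_chain[OF f2 assms(4), of m] assms(2) unfolding \<Phi>_def w1_def by auto
  have l1: "1 - \<kappa> + 3 * \<nu> < ll w1" "ll w1 < -(24/25)"
    using return_estimate[OF assms(3,4)] ch(1) by linarith+
  \<comment> \<open>The line through w1 has positive slope and negative intercept, so it is below
    the axis wherever x \<le> 0, whereas a nonnegative height at this value of \<open>ll\<close>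
    would force x \<le> 0.\<close>
  have "snd w1 < 0"
  proof (rule ccontr)
    assume n: "\<not> snd w1 < 0"
    then have "0 \<le> snd w1 / \<kappa>" using kappa by simp
    then have "fst w1 \<le> 0" using l1(2) unfolding ll_def by linarith
    then have "fst (LR (LR \<sigma>)) * fst w1 \<le> 0" using b1 nu by (intro mult_nonneg_nonpos) auto
    then show False using n ch(2) b1 nu unfolding DL_def by linarith
  qed
  then have p2: "0 < fst w2" by (simp add: w2_def snd_neg_iff)
  have D2: "DL (LR \<sigma>) w2 = 0"
    using DL_LR_inv[OF f1, of w1] ch(2) p2 b1 nu unfolding w2_def by simp
  have y2: "snd w2 = fst (LR \<sigma>) * (fst w2 - 1 - snd \<sigma>)"
  proof -
    have "snd (LR \<sigma>) = - fst (LR \<sigma>) * (1 + snd \<sigma>)" by (simp add: LR_def Let_def)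
    then show ?thesis using D2 by (simp add: DL_def algebra_simps)
  qed
  have ll1: "ll w1 = 1 + snd w2 - (\<kappa> + 2 * \<nu>) * fst w2"
    using ll_coords[of w1] p2 unfolding w2_def by (simp add: algebra_simps)
  \<comment> \<open>The point (1 + c, 0), with c the intercept of \<sigma>, is the image of the
    point of \<sigma> on the critical line, that is, the tip of the fold. Beyond it the next image
    would lie left of 1 - \<kappa> + 3\<nu>.\<close>
  have le: "fst w2 \<le> 1 + snd \<sigma>"
  proof (rule ccontr)
    assume "\<not> fst w2 \<le> 1 + snd \<sigma>"
    then have "0 < (fst w2 - 1 - snd \<sigma>) * (\<kappa> + 2 * \<nu> - fst (LR \<sigma>))"
      using b2 kappa nu nu_small by (intro mult_pos_pos) auto
    then have "ll w1 < 1 - (\<kappa> + 2 * \<nu>) * (1 + snd \<sigma>)"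
      using ll1 y2 by (simp add: algebra_simps)
    moreover have "(\<kappa> + 2 * \<nu>) * (1 - 2 * \<nu>) \<le> (\<kappa> + 2 * \<nu>) * (1 + snd \<sigma>)"
      using assms(1) kappa nu unfolding flat_def by (intro mult_left_mono) auto
    moreover have "(\<kappa> + 2 * \<nu>) * (1 - 2 * \<nu>) = \<kappa> + 2 * \<nu> - 2 * (\<kappa> * \<nu>) - 4 * (\<nu> * \<nu>)"
      by algebra
    moreover have "\<nu> * \<nu> \<le> (1/100000) * \<nu>" using nu nu_small by (intro mult_right_mono) auto
    ultimately show False using l1 kappa_nu nu by linarith
  qed
  have "snd w2 \<le> 0" unfolding y2 using le b2 nu by (intro mult_nonneg_nonpos) auto
  then have p: "0 \<le> fst w" using snd_pos_iff[of w2] unfolding w by linarith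
  then show "0 \<le> fst w" .
  show D: "DL \<sigma> w = 0"
    using DL_LR_inv[OF assms(1), of w2] D2 p b2 nu unfolding w by simp
  have c: "\<bar>snd \<sigma>\<bar> \<le> (1/1000)" using assms(1) nu_small unfolding flat_def by linarith
  have "fst (LR \<sigma>) * (-(11/10)) \<le> fst (LR \<sigma>) * (fst w2 - 1 - snd \<sigma>)"
    using p2 c b2 nu by (intro mult_left_mono) auto
  then have "-(1/1000) \<le> snd w2" using y2 b2 nu_small nu by linarith
  then have "(1959/1000) \<le> (\<kappa> + 2 * \<nu>) * fst w2" using ll1 l1(2) by linarith
  moreover have "(\<kappa> + 2 * \<nu>) * fst w2 \<le> 2 * fst w2"
    using p2 kappa nu by (intro mult_right_mono) auto
  ultimately have x2: "(979/1000) \<le> fst w2" by linarith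
  have "fst w2 = 1 + snd w - (\<kappa> + \<nu>) * fst w" using inv_coords(2)[of w2] p unfolding w by simp
  moreover have "snd w = fst \<sigma> * fst w + snd \<sigma>" using D by (simp add: DL_def)
  ultimately have "\<kappa> * fst w \<le> (3/100) + fst \<sigma> * fst w - \<nu> * fst w"
    using x2 c by (simp add: algebra_simps)
  then show "fst w \<le> (3/50)"
    using product_bounds[of "fst w"] flat_abs_le[OF assms(1), of "fst w"] unfolding abs_of_nonneg[OF p] by linarith
qed

section \<open>Straight pieces of the unstable manifold that span the window\<close>

definition unst :: "(real \<times> real) set" where
  "unst = {\<sigma>. flat \<sigma> \<and> (\<forall>x\<in>{-(17/50)..9/50}. (x, fst \<sigma> * x + snd \<sigma>) \<in> W)}"

lemma unst_point: "\<sigma> \<in> unst \<Longrightarrow> DL \<sigma> w = 0 \<Longrightarrow> -(17/50) \<le> fst w \<Longrightarrow> fst w \<le> (9/50) \<Longrightarrow> w \<in> W"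
proof -
  assume *: "\<sigma> \<in> unst" "DL \<sigma> w = 0" "-(17/50) \<le> fst w" "fst w \<le> 9/50"
  then have "(fst w, fst \<sigma> * fst w + snd \<sigma>) \<in> W" by (simp add: unst_def)
  moreover have "(fst w, fst \<sigma> * fst w + snd \<sigma>) = w"
    using *(2) by (simp add: DL_def prod_eq_iff)
  ultimately show "w \<in> W" by simp
qed

lemma unstI:
  assumes "flat \<sigma>" "\<And>z. DL \<sigma> z = 0 \<Longrightarrow> -(17/50) \<le> fst z \<Longrightarrow> fst z \<le> (9/50) \<Longrightarrow> z \<in> W"
  shows "\<sigma> \<in> unst"
  using assms by (auto simp: unst_def DL_def)

lemma ll_near: "\<bar>snd z\<bar> \<le> 4 * \<nu> \<Longrightarrow> \<bar>ll z - fst z\<bar> \<le> (1/1000)" "\<bar>snd z\<bar> \<le> 4 * \<nu> \<Longrightarrow> \<bar>rr z - fst z\<bar> \<le> (1/1000)"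
  using nu_small kappa by (auto simp: ll_def rr_def abs_divide divide_le_eq)

lemma window_snd:
  assumes "flat \<sigma>" "DL \<sigma> z = 0" "-(17/50) \<le> fst z" "fst z \<le> (9/50)"
  shows "\<bar>snd z\<bar> \<le> 3 * \<nu>"
proof -
  have "\<nu> * \<bar>fst z\<bar> \<le> \<nu> * (17/50)" using assms nu by (intro mult_left_mono) auto
  then show ?thesis
    using flat_abs_le[OF assms(1), of "fst z"] assms(1,2) nu unfolding DL_def flat_def by linarith
qed

lemma unst_\<Phi>: "\<sigma> \<in> unst \<Longrightarrow> \<Phi> \<sigma> \<in> unst"
proof (rule unstI)
  assume s: "\<sigma> \<in> unst"
  then have fl: "flat \<sigma>" by (simp add: unst_def)
  then show "flat (\<Phi> \<sigma>)" by (rule flat_\<Phi>)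
  fix z assume z: "DL (\<Phi> \<sigma>) z = 0" "-(17/50) \<le> fst z" "fst z \<le> (9/50)"
  have "\<bar>snd z\<bar> \<le> 4 * \<nu>" using window_snd[OF flat_\<Phi>[OF fl] z] nu by linarith
  then have "-(341/1000) \<le> ll z" "ll z \<le> (1/5)" using ll_near(1)[of z] z by linarith+
  note r = return_backward[OF fl z(1) this]
  have "(inv F ^^ (m + 2)) z \<in> W" by (rule unst_point[OF s r(1)]) (use r in linarith)+
  then show "z \<in> W" unfolding W_inv_pow_iff .
qed

lemma unst_base: "(\<nu>, hX) \<in> unst"
proof (rule unstI)
  show fl: "flat (\<nu>, hX)" using hX_bounds nu by (simp add: flat_def)
  fix z assume z: "DL (\<nu>, hX) z = 0" "-(17/50) \<le> fst z" "fst z \<le> (9/50)"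
  have "\<bar>snd z\<bar> \<le> 4 * \<nu>" using window_snd[OF fl z] nu by linarith
  then have "-(9/20) < rr z" "rr z < (19/20)" using ll_near(2)[of z] z by linarith+
  moreover have "hh z = hX" using z(1) by (simp add: DL_def hh_def)
  ultimately show "z \<in> W" by (intro unstable_line_in_W)
qed

lemma lower_line_neg:
  assumes "flat \<sigma>" "-(17/50) \<le> x" "x \<le> (9/50)"
  shows "fst (LR \<sigma>) * x + snd (LR \<sigma>) < 0"
proof -
  note b = LR_bounds[OF assms(1)]
  have "fst (LR \<sigma>) * x \<le> fst (LR \<sigma>) * (9/50)" using assms b nu by (intro mult_left_mono) auto
  then show ?thesis using b nu by linarith
qed

lemma upper_line_pos:
  assumes "flat \<sigma>" "0 \<le> x" "x \<le> (7/10)"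
  shows "0 < fst (LL \<sigma>) * x + snd (LL \<sigma>)"
proof -
  note b = LL_bounds[OF assms(1)]
  have "- fst (LL \<sigma>) * x \<le> - fst (LL \<sigma>) * (7/10)" using assms b nu by (intro mult_left_mono) auto
  then show ?thesis using b nu by linarith
qed

text \<open>Two backward steps carry the piece over the window first to x between 2/5 and 17/25,
  where the line \<open>LL \<sigma>\<close> is above the axis, and then to x between -8/25 and 0,
  again over the window. These lines bound G from below.\<close>

lemma unst_LR_LL:
  assumes s: "\<sigma> \<in> unst"
  shows "LR (LL \<sigma>) \<in> unst"
proof (rule unstI)
  have fl: "flat \<sigma>" using s by (simp add: unst_def)
  then have f1: "flat (LL \<sigma>)" by (rule flat_LL)
  then show "flat (LR (LL \<sigma>))" by (rule flat_LR)
  note b1 = LR_bounds[OF f1] and b2 = LL_bounds[OF fl]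
  fix z assume z: "DL (LR (LL \<sigma>)) z = 0" "-(17/50) \<le> fst z" "fst z \<le> (9/50)"
  let ?w1 = "inv F z" and ?w = "inv F (inv F z)"
  have "snd z < 0" using lower_line_neg[OF f1 z(2,3)] z(1) by (simp add: DL_def)
  then have p: "0 < fst ?w1" by (simp add: snd_neg_iff)
  then have D1: "DL (LL \<sigma>) ?w1 = 0" using DL_LR_inv[OF f1, of z] z(1) b1 nu by simp
  have y1: "snd ?w1 = fst (LL \<sigma>) * fst ?w1 + snd (LL \<sigma>)" using D1 by (simp add: DL_def)
  have c: "\<bar>snd (LL \<sigma>)\<bar> \<le> (1/1000)" "\<bar>snd \<sigma>\<bar> \<le> (1/1000)" using f1 fl nu_small unfolding flat_def by linarith+
  have "(\<kappa> + \<nu>) * fst ?w1 = 1 + snd ?w1 - fst z" using inv_coords(2)[of z] p by simp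
  then have e1: "\<kappa> * fst ?w1 + \<nu> * fst ?w1 = 1 + snd ?w1 - fst z" by (simp add: algebra_simps)
  have x1: "(2/5) \<le> fst ?w1" "fst ?w1 \<le> (17/25)"
    using e1 y1 c z p product_bounds[of "fst ?w1"] flat_abs_le[OF f1, of "fst ?w1"]
    unfolding abs_of_pos[OF p] by linarith+
  have "0 < snd ?w1" unfolding y1 by (rule upper_line_pos[OF fl]) (use x1 in linarith)+
  then have n: "fst ?w < 0" by (simp add: snd_pos_iff)
  then have D: "DL \<sigma> ?w = 0" using DL_LL_inv[OF fl, of ?w1] D1 b2 nu by simp
  have y: "snd ?w = fst \<sigma> * fst ?w + snd \<sigma>" using D by (simp add: DL_def)
  have e: "\<kappa> * \<bar>fst ?w\<bar> + \<nu> * \<bar>fst ?w\<bar> = 1 + snd ?w - fst ?w1"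
    using inv_coords(2)[of ?w1] by (simp add: algebra_simps)
  have "\<bar>fst ?w\<bar> \<le> (8/25)"
    using e y c x1 product_bounds[of "fst ?w"] flat_abs_le[OF fl, of "fst ?w"] by linarith
  then have "?w \<in> W" using n by (intro unst_point[OF s D]) linarith+
  then show "z \<in> W" unfolding W_inv_iff .
qed

section \<open>The maximal invariant set over the window\<close>

definition U :: "(real \<times> real) set" where
  "U = {z. - \<kappa> / 2 < fst z \<and> fst z < 1 + 4 * \<nu> \<and> - 3 * \<nu> < snd z \<and> snd z < 3 * \<nu>}"

definition Ubar :: "(real \<times> real) set" where
  "Ubar = {z. - \<kappa> / 2 \<le> fst z \<and> fst z \<le> 1 + 4 * \<nu> \<and> - 3 * \<nu> \<le> snd z \<and> snd z \<le> 3 * \<nu>}"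

lemma open_U: "open U"
  unfolding U_def by (intro open_Collect_conj open_Collect_less continuous_intros)

lemma closed_Ubar: "closed Ubar"
  unfolding Ubar_def by (intro closed_Collect_conj closed_Collect_le continuous_intros)

lemma U_subset_Ubar: "U \<subseteq> Ubar"
  by (auto simp: U_def Ubar_def)

lemma closure_U: "closure U \<subseteq> Ubar"
  by (rule closure_minimal[OF U_subset_Ubar closed_Ubar])

text \<open>The delicate side of the box is the left one: 1 - \<kappa> - 13\<nu> > - \<kappa> / 2
  because (2 - \<kappa>) / 2 > 500\<nu>.\<close>

lemma F_Ubar:
  assumes "z \<in> Ubar"
  shows "1 - \<kappa> - 13 * \<nu> \<le> fst (F z)" "fst (F z) \<le> 1 + 3 * \<nu>" "\<bar>snd (F z)\<bar> \<le> (21/10) * \<nu>"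
proof -
  have x: "\<bar>fst z\<bar> \<le> 1 + 4 * \<nu>" and y: "\<bar>snd z\<bar> \<le> 3 * \<nu>"
    using assms kappa nu unfolding Ubar_def by auto
  have "\<nu> * \<nu> \<le> (1/100000) * \<nu>" using nu nu_small by (intro mult_right_mono) auto
  moreover have "(\<kappa> + \<nu>) * \<bar>fst z\<bar> \<le> (\<kappa> + \<nu>) * (1 + 4 * \<nu>)"
    using x kappa nu by (intro mult_left_mono) auto
  moreover have "(\<kappa> + \<nu>) * (1 + 4 * \<nu>) = \<kappa> + \<nu> + 4 * (\<kappa> * \<nu>) + 4 * (\<nu> * \<nu>)" by algebra
  moreover have "0 \<le> (\<kappa> + \<nu>) * \<bar>fst z\<bar>" using kappa nu by simp
  ultimately show "1 - \<kappa> - 13 * \<nu> \<le> fst (F z)" "fst (F z) \<le> 1 + 3 * \<nu>"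
    using y kappa_nu nu unfolding F_coords by linarith+
  have "\<kappa> * \<nu> * \<bar>fst z\<bar> \<le> (2 * \<nu>) * (101/100)"
    using x nu_small nu kappa_nu by (intro mult_mono) auto
  then show "\<bar>snd (F z)\<bar> \<le> (21/10) * \<nu>" using kappa_nu nu by (simp add: abs_mult)
qed

lemma F_Ubar_U: "z \<in> Ubar \<Longrightarrow> F z \<in> U"
  using F_Ubar[of z] nu kappa unfolding U_def mem_Collect_eq by linarith

lemma trapping_U: "trapping_region F U"
  using open_U closure_U F_Ubar_U unfolding trapping_region_def by blast

lemma X_in_U: "X \<in> U"
proof -
  have "snd X = - (\<kappa> * \<nu> * fst X)" using F_coords(2)[of X] X_fixed by simp
  moreover have "\<kappa> * \<nu> * fst X \<le> (2 * \<nu>) * 1" using X_coords kappa_nu nu by (intro mult_mono) auto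
  moreover have "0 \<le> \<kappa> * \<nu> * fst X" using X_coords kappa_nu by simp
  ultimately show ?thesis using X_coords(1,2) kappa nu unfolding U_def mem_Collect_eq by linarith
qed

lemma bounded_U: "bounded U"
proof -
  have "U \<subseteq> {-2..2} \<times> {-2..2}" using kappa nu nu_small by (auto simp: U_def)
  then show ?thesis by (rule bounded_subset[OF bounded_Times[OF bounded_closed_interval bounded_closed_interval]])
qed

definition G :: "(real \<times> real) set" where "G = max_inv F U"

lemma G_inv: "z \<in> G \<Longrightarrow> (inv F ^^ n) z \<in> G" and G_inv1: "z \<in> G \<Longrightarrow> inv F z \<in> G"
  unfolding G_def using max_inv_inv[of z F U n] max_inv_inv[of z F U 1] by simp_all

text \<open>The fourth bound keeps G at a definite distance from the stable leaf of the left fixed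
  point. It limits the number of consecutive backward steps on the left.\<close>

lemma G_bounds:
  assumes "z \<in> G"
  shows "1 - \<kappa> - 13 * \<nu> \<le> fst z" "fst z \<le> 1 + 3 * \<nu>" "\<bar>snd z\<bar> \<le> (21/10) * \<nu>"
    "(197/100) * (2 - \<kappa>) \<le> ll z - lY"
proof -
  have "inv F z \<in> Ubar"
    using G_inv1[OF assms] max_inv_subset U_subset_Ubar unfolding G_def by blast
  from F_Ubar[OF this] show b: "1 - \<kappa> - 13 * \<nu> \<le> fst z" "fst z \<le> 1 + 3 * \<nu>" "\<bar>snd z\<bar> \<le> (21/10) * \<nu>"
    by simp_all
  have "\<bar>snd z / \<kappa>\<bar> \<le> (21/10) * \<nu> / 1" unfolding abs_divide using b(3) kappa by (intro frac_le) auto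
  then have l: "1 - \<kappa> - (151/10) * \<nu> \<le> ll z" using b(1) unfolding ll_def by linarith
  have "lY * (\<kappa> - 1) = -1" using kappa by (simp add: lY_def)
  then have id: "1 - \<kappa> - lY = - lY * (\<kappa> * (2 - \<kappa>))" by algebra
  moreover have "1 * ((199/100) * (2 - \<kappa>)) \<le> - lY * (\<kappa> * (2 - \<kappa>))"
    using kappa lY_bounds by (intro mult_mono mult_right_mono) auto
  ultimately show "(197/100) * (2 - \<kappa>) \<le> ll z - lY" using l nu by argo
qed

lemma W_subset_G: "W \<subseteq> G"
  unfolding W_def G_def by (rule unstable_subset_max_inv[OF bij_F trapping_U X_fixed X_in_U])

text \<open>The sides of the window: \<open>gL z = 0\<close> puts \<open>F z\<close>, and \<open>gR z = 0\<close> puts the third iterate of \<open>z\<close>, on the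
  local stable manifold \<open>rr = rX\<close> of the fixed point.\<close>

definition gL :: "real \<times> real \<Rightarrow> real" where
  "gL z = snd z + (\<kappa> + 2 * \<nu>) * fst z + \<kappa> / (1 + \<kappa>)"
text \<open>The right branch extended affinely to the whole plane, so that \<open>gR\<close> is
  affine and its sign is meaningful everywhere.\<close>

definition fR :: "real \<times> real \<Rightarrow> real \<times> real" where
  "fR z = (1 + snd z - (\<kappa> + \<nu>) * fst z, - (\<kappa> * \<nu>) * fst z)"
definition gR :: "real \<times> real \<Rightarrow> real" where
  "gR z = gL (fR (fR z))"
definition M :: "real \<times> real \<Rightarrow> bool" where
  "M z \<longleftrightarrow> 0 \<le> gL z \<and> gR z \<le> 0"

lemma kappa_frac: "(1331/2000) < \<kappa> / (1 + \<kappa>)" "\<kappa> / (1 + \<kappa>) < (6667/10000)"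
  using kappa by (simp_all add: field_simps)

lemma F_eq_fR: "0 \<le> fst z \<Longrightarrow> F z = fR z"
  by (simp add: fR_def prod_eq_iff)

text \<open>At \<kappa> = 2 and \<nu> = 0, on the axis, the functional is 2x + 2/3, which vanishes
  at x = -1/3.\<close>

lemma gL_estimate: "\<bar>gL z - (2 * fst z + (333/500))\<bar> \<le> \<bar>snd z\<bar> + (101/10000) * \<bar>fst z\<bar> + (1/1000)"
proof -
  have "(\<kappa> + 2 * \<nu>) * fst z = \<kappa> * fst z + 2 * (\<nu> * fst z)" by (simp add: algebra_simps)
  moreover have "\<bar>\<kappa> * fst z - 2 * fst z\<bar> \<le> (1/100) * \<bar>fst z\<bar>"
    unfolding left_diff_distrib[symmetric] abs_mult using kappa by (intro mult_right_mono) auto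
  moreover have "\<bar>\<nu> * fst z\<bar> \<le> (1/100000) * \<bar>fst z\<bar>"
    using product_bounds(1)[of "fst z"] nu by (simp add: abs_mult)
  ultimately show ?thesis using kappa_frac unfolding gL_def by linarith
qed

text \<open>At \<kappa> = 2 and \<nu> = 0, on the axis, the functional is 8x - 4/3, which vanishes
  at x = 1/6; the limit orbit is 1/6, 2/3, -1/3, 1/3.\<close>

lemma gR_estimate:
  "\<bar>gR z - (8 * fst z - (1333/1000))\<bar> \<le> 5 * \<bar>snd z\<bar> + (1/5) * \<bar>fst z\<bar> + (1/25)"
proof -
  have kk: "\<kappa> * \<kappa> \<le> 2 * 2" "(199/100) * (199/100) \<le> \<kappa> * \<kappa>" using kappa by (intro mult_mono; simp)+
  have kkk: "\<kappa> * \<kappa> * \<kappa> \<le> (2 * 2) * 2" "((199/100) * (199/100)) * (199/100) \<le> \<kappa> * \<kappa> * \<kappa>" using kappa kk by (intro mult_mono kk; simp)+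
  define C0 where "C0 = - (\<kappa> * \<nu>) + (\<kappa> + 2 * \<nu>) - (\<kappa> + 2 * \<nu>) * (\<kappa> + \<nu>) + \<kappa> / (1 + \<kappa>)"
  define Cy where "Cy = - (\<kappa> * \<nu>) - (\<kappa> + 2 * \<nu>) * (\<kappa> + \<nu>)"
  define Cx where "Cx = (\<kappa> * \<nu>) * (\<kappa> + \<nu>) - (\<kappa> + 2 * \<nu>) * (\<kappa> * \<nu>) + (\<kappa> + 2 * \<nu>) * (\<kappa> + \<nu>) * (\<kappa> + \<nu>)"
  have eq: "gR z = C0 + Cy * snd z + Cx * fst z"
    unfolding gR_def gL_def fR_def C0_def Cy_def Cx_def fst_conv snd_conv
    by (simp only: ring_distribs mult_1_left mult_1_right mult_minus_left mult_minus_right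
        minus_diff_eq diff_conv_add_uminus minus_add_distrib minus_minus mult_ac add_ac)
  have nn: "0 \<le> \<nu> * \<nu>" "\<nu> * \<nu> \<le> (1/100000) * \<nu>" using nu nu_small by (auto intro!: mult_right_mono)
  have P: "(\<kappa> + 2 * \<nu>) * (\<kappa> + \<nu>) = \<kappa> * \<kappa> + 3 * (\<kappa> * \<nu>) + 2 * (\<nu> * \<nu>)" by algebra
  have P1: "\<kappa> * \<kappa> \<le> (\<kappa> + 2 * \<nu>) * (\<kappa> + \<nu>)" "(\<kappa> + 2 * \<nu>) * (\<kappa> + \<nu>) \<le> \<kappa> * \<kappa> + 7 * \<nu>"
    using P nn kappa_nu nu by linarith+
  have "\<bar>C0 + (1333/1000)\<bar> \<le> (1/25)"
  proof -
    have "C0 = - (\<kappa> * \<nu>) + \<kappa> + 2 * \<nu> - (\<kappa> + 2 * \<nu>) * (\<kappa> + \<nu>) + \<kappa> / (1 + \<kappa>)" by (simp add: C0_def)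
    \<comment> \<open>The chord of the square over [199/100, 2] bounds \<kappa> * \<kappa> above by
      a linear expression.\<close>
    moreover have "0 \<le> (\<kappa> - (199/100)) * (2 - \<kappa>)" using kappa by (intro mult_nonneg_nonneg) auto
    moreover have "(\<kappa> - 199/100) * (2 - \<kappa>) = 399/100 * \<kappa> - 199/50 - \<kappa> * \<kappa>"
      by (simp add: field_simps)
    ultimately show ?thesis using kk kappa kappa_frac P1 kappa_nu nu nu_small by linarith
  qed
  moreover have "\<bar>Cy\<bar> \<le> 5" unfolding Cy_def using P1 kk kappa_nu nu nu_small by linarith
  then have "\<bar>Cy * snd z\<bar> \<le> 5 * \<bar>snd z\<bar>" unfolding abs_mult by (intro mult_right_mono) auto
  moreover have "\<bar>Cx - 8\<bar> \<le> (1/5)"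
  proof -
    have "Cx = (\<kappa> + 2 * \<nu>) * (\<kappa> + \<nu>) * (\<kappa> + \<nu>) - \<nu> * (\<kappa> * \<nu>)"
      unfolding Cx_def by algebra
    moreover have "\<kappa> * \<kappa> * \<kappa> \<le> (\<kappa> + 2 * \<nu>) * (\<kappa> + \<nu>) * (\<kappa> + \<nu>)"
      using P1 kappa nu by (intro mult_mono) auto
    moreover have "(\<kappa> + 2 * \<nu>) * (\<kappa> + \<nu>) * (\<kappa> + \<nu>) \<le> ((201/100) * 2) * 2"
      using kappa nu by (intro mult_mono) auto
    moreover have "0 \<le> \<nu> * (\<kappa> * \<nu>)" "\<nu> * (\<kappa> * \<nu>) \<le> (1/100000) * (1/50000)"
      using nu kappa_nu nu_small kappa by (intro mult_nonneg_nonneg mult_mono; linarith)+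
    ultimately show ?thesis using kkk by linarith
  qed
  then have "\<bar>(Cx - 8) * fst z\<bar> \<le> (1/5) * \<bar>fst z\<bar>" unfolding abs_mult by (intro mult_right_mono) auto
  moreover have "gR z - (8 * fst z - (1333/1000)) = (C0 + (1333/1000)) + Cy * snd z + (Cx - 8) * fst z"
    unfolding eq by algebra
  ultimately show ?thesis by linarith
qed

text \<open>The endpoints are those in \<open>unst\<close>. The bound on the height grows with |x|
  because in \<open>Quad_bounds\<close> the height is controlled only relative to x until x itself
  is bounded.\<close>

lemma M_bounds:
  assumes "M z" "\<bar>snd z\<bar> \<le> (1/1000) * (1 + \<bar>fst z\<bar>)"
  shows "-(17/50) < fst z" "fst z < (9/50)"
  using assms gL_estimate[of z] gR_estimate[of z] unfolding M_def distrib_left by linarith+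

lemma M_I:
  assumes "-(33/100) \<le> fst z" "fst z \<le> (3/20)" "\<bar>snd z\<bar> \<le> (1/10000)"
  shows "M z"
  using assms gL_estimate[of z] gR_estimate[of z] unfolding M_def by linarith

section \<open>Upper and lower envelopes of G over the window\<close>

lemma G_window:
  assumes "z \<in> G" "M z"
  shows "-(17/50) < fst z" "fst z < (9/50)" "-(341/1000) \<le> ll z" "ll z \<le> (181/1000)"
proof -
  have y: "\<bar>snd z\<bar> \<le> (1/10000)" using G_bounds(3)[OF assms(1)] nu nu_small by linarith
  then have "\<bar>snd z\<bar> \<le> (1/1000) * (1 + \<bar>fst z\<bar>)" unfolding distrib_left by linarith
  from M_bounds[OF assms(2) this] show 1: "-(17/50) < fst z" "fst z < (9/50)" .
  have "\<bar>snd z\<bar> \<le> 4 * \<nu>" using G_bounds(3)[OF assms(1)] nu by linarith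
  then show "-(341/1000) \<le> ll z" "ll z \<le> (181/1000)" using ll_near(1)[of z] 1 by linarith+
qed

text \<open>Being above the image line forces the last m steps to be on the left. Two order
  reversals on the right then put w above \<sigma>, near the critical line and hence in the window.
  Forward contraction of heights becomes growth by a factor of at least 2.\<close>

lemma lift_above:
  assumes "flat \<sigma>" "z \<in> G" "M z" "0 < DL (\<Phi> \<sigma>) z"
  defines "w \<equiv> (inv F ^^ (m + 2)) z"
  shows "w \<in> G" "M w" "DL (\<Phi> \<sigma>) z \<le> (1/2) * DL \<sigma> w"
proof -
  show wG: "w \<in> G" unfolding w_def by (rule G_inv[OF assms(2)])
  define w1 where "w1 = (inv F ^^ m) z"
  define w2 where "w2 = inv F w1"
  have w: "w = inv F w2" by (simp add: w_def w2_def w1_def)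
  have G1: "w1 \<in> G" "w2 \<in> G" unfolding w2_def w1_def using G_inv[OF assms(2)] G_inv1 by blast+
  have f1: "flat (LR \<sigma>)" and f2: "flat (LR (LR \<sigma>))" using assms(1) flat_LR by auto
  note b1 = LR_bounds[OF f1] and b2 = LR_bounds[OF assms(1)]
  note win = G_window[OF assms(2,3)]
  have lz: "ll z \<le> (1/5)" using win by linarith
  obtain C where C: "ll w1 - lY = (ll z - lY) / \<kappa> ^ m" "0 < C" "C \<le> 1"
    "DL (\<Phi> \<sigma>) z = C * DL (LR (LR \<sigma>)) w1"
    using left_chain[OF f2 lz, of m] assms(4) unfolding \<Phi>_def w1_def by auto
  have D1: "0 < DL (LR (LR \<sigma>)) w1" using C assms(4) by (simp add: zero_less_mult_iff)
  have l1: "ll w1 < -(24/25)" using return_estimate(2)[OF win(3) lz] C(1) by linarith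
  \<comment> \<open>Another step on the left would bring w2 closer to the leaf through the left
    fixed point than any point of G can be.\<close>
  have p2: "0 \<le> fst w2"
  proof (rule ccontr)
    assume "\<not> 0 \<le> fst w2"
    then have "ll w1 = 1 + \<kappa> * ll w2" using ll_inv[of w1] unfolding w2_def by simp
    then have "ll w1 - lY = \<kappa> * (ll w2 - lY)" using lY_eq by (simp add: algebra_simps)
    then have "ll w2 - lY = (ll w1 - lY) / \<kappa>" using kappa by simp
    then have "ll w2 - lY < (19/10) * (2 - \<kappa>)"
      using return_estimate(3)[OF win(3) lz win(4)] C(1) by simp
    then show False using G_bounds(4)[OF G1(2)] kappa by argo
  qed
  have D12: "DL (LR (LR \<sigma>)) w1 = - fst (LR (LR \<sigma>)) * DL (LR \<sigma>) w2"
    using DL_LR_inv[OF f1, of w1] p2 unfolding w2_def by simp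
  then have D2: "DL (LR \<sigma>) w2 < 0"
    using D1 b1 nu by (simp add: mult_less_0_iff)
  \<comment> \<open>The side of w is not known here. If w is on the left, folding only makes d
    smaller than the height of w above \<sigma>, so the estimate still points the right way.\<close>
  define d where "d = DL \<sigma> w - 2 * (\<kappa> + \<nu>) * max 0 (- fst w)"
  have Dd: "DL (LR \<sigma>) w2 = - fst (LR \<sigma>) * d"
    using DL_LR_inv[OF assms(1), of w2] unfolding w d_def by simp
  then have d0: "0 < d" using D2 b2 nu by (simp add: zero_less_mult_iff)
  have dle: "d \<le> DL \<sigma> w" unfolding d_def using kappa nu by simp
  have "DL (\<Phi> \<sigma>) z = (C * (fst (LR (LR \<sigma>)) * fst (LR \<sigma>))) * d"
    using C(4) D12 Dd by simp
  also have "\<dots> \<le> (1 * (1 * (1/2))) * d"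
    using C b1 b2 nu nu_small d0 by (intro mult_right_mono mult_mono) auto
  also have "\<dots> \<le> (1/2) * DL \<sigma> w" using dle by simp
  finally show "DL (\<Phi> \<sigma>) z \<le> (1/2) * DL \<sigma> w" .
  have y2: "\<bar>snd w2\<bar> \<le> (1/10000)" and y: "\<bar>snd w\<bar> \<le> (1/10000)"
    using G_bounds(3)[OF G1(2)] G_bounds(3)[OF wG] nu nu_small by linarith+
  have "ll w1 = 1 + snd w2 - (\<kappa> * fst w2 + \<nu> * fst w2) - \<nu> * fst w2"
    using ll_coords[of w1] p2 unfolding w2_def by (simp add: algebra_simps)
  then have x2: "(97/100) \<le> fst w2" using l1 y2 product_bounds[of "fst w2"] unfolding abs_of_nonneg[OF p2] by linarith
  have "fst w2 = 1 + snd w - (\<kappa> * \<bar>fst w\<bar> + \<nu> * \<bar>fst w\<bar>)"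
    using inv_coords(2)[of w2] unfolding w by (simp add: algebra_simps)
  then have "\<bar>fst w\<bar> \<le> (3/50)" using x2 y product_bounds[of "fst w"] by linarith
  then show "M w" using y by (intro M_I) linarith+
qed

definition \<sigma>0 :: "real \<times> real" where "\<sigma>0 = (\<nu>, hX)"

lemma unst_pow: "(\<Phi> ^^ k) \<sigma>0 \<in> unst"
  by (induction k) (use unst_base unst_\<Phi> in \<open>auto simp: \<sigma>0_def\<close>)

lemma unst_flat: "\<sigma> \<in> unst \<Longrightarrow> flat \<sigma>"
  by (simp add: unst_def)

text \<open>Each return pulls a positive height back to at least its double, and heights over
  \<open>\<sigma>0\<close> in the window are at most 1.\<close>

lemma DL_pow_le:
  assumes "z \<in> G" "M z"
  shows "DL ((\<Phi> ^^ k) \<sigma>0) z \<le> (1/2) ^ k"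
  using assms
proof (induction k arbitrary: z)
  case 0
  have "\<bar>fst z\<bar> \<le> 1" "\<bar>snd z\<bar> \<le> (1/10)"
    using G_window[OF 0] G_bounds(3)[OF 0(1)] nu nu_small by auto
  moreover have "\<nu> * \<bar>fst z\<bar> \<le> (1/100000) * \<bar>fst z\<bar>" by (rule product_bounds)
  moreover have "\<bar>\<nu> * fst z\<bar> = \<nu> * \<bar>fst z\<bar>" using nu by (simp add: abs_mult)
  ultimately show ?case
    using hX_bounds nu nu_small by (simp add: DL_def \<sigma>0_def)
next
  case (Suc k)
  let ?s = "(\<Phi> ^^ k) \<sigma>0"
  show ?case
  proof (cases "0 < DL (\<Phi> ?s) z")
    case True
    note l = lift_above[OF unst_flat[OF unst_pow] Suc.prems True]
    then show ?thesis using Suc.IH[OF l(1,2)] by simp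
  next
    case False
    have "0 \<le> (1/2::real) ^ Suc k" by simp
    then show ?thesis using False unfolding funpow.simps comp_apply by linarith
  qed
qed

text \<open>The vertical projections to the lines lie in W, and by \<open>DL_pow_le\<close> they
  converge to z.\<close>

lemma above_all_closure:
  assumes "z \<in> G" "M z" "\<And>k. 0 < DL ((\<Phi> ^^ k) \<sigma>0) z"
  shows "z \<in> closure W"
proof -
  define p where "p k = (fst z, fst ((\<Phi> ^^ k) \<sigma>0) * fst z + snd ((\<Phi> ^^ k) \<sigma>0))" for k
  have "p k \<in> W" for k
    using unst_pow[of k] G_window[OF assms(1,2)] unfolding unst_def p_def by auto
  moreover have "p \<longlonglongrightarrow> z"
  proof -
    have d: "dist (p k) z \<le> (1/2) ^ k" for k
      using DL_pow_le[OF assms(1,2), of k] assms(3)[of k]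
      by (simp add: p_def dist_prod_def dist_real_def DL_def)
    have "(\<lambda>k. (1/2::real) ^ k) \<longlonglongrightarrow> 0" by (rule LIMSEQ_realpow_zero) auto
    then have "(\<lambda>k. dist (p k) z) \<longlonglongrightarrow> 0"
      by (rule Lim_null_comparison[rotated]) (use d in simp)
    then show ?thesis unfolding tendsto_dist_iff[of p] .
  qed
  ultimately show ?thesis using closure_sequential[of z W] by blast
qed

text \<open>The reflection of the upper envelope to the lower one: left preserves the vertical
  order, right reverses it, so a point below pulls back in two steps to a point above. Neither step
  is folded.\<close>

lemma lift_below:
  assumes "flat \<sigma>" "z \<in> G" "M z" "DL (LR (LL \<sigma>)) z < 0"
  defines "w \<equiv> inv F (inv F z)"
  shows "w \<in> G" "M w" "0 < DL \<sigma> w"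
proof -
  let ?w1 = "inv F z"
  show wG: "w \<in> G" unfolding w_def using G_inv1 assms(2) by blast
  have G1: "?w1 \<in> G" using G_inv1 assms(2) by blast
  note win = G_window[OF assms(2,3)]
  have f1: "flat (LL \<sigma>)" using assms(1) by (rule flat_LL)
  note b1 = LR_bounds[OF f1] and b2 = LL_bounds[OF assms(1)]
  have y1: "\<bar>snd ?w1\<bar> \<le> (1/10000)" and y: "\<bar>snd w\<bar> \<le> (1/10000)"
    using G_bounds(3)[OF G1] G_bounds(3)[OF wG] nu nu_small by linarith+
  have "snd z < 0" using lower_line_neg[OF f1, of "fst z"] win assms(4) unfolding DL_def by linarith
  then have p: "0 < fst ?w1" by (simp add: snd_neg_iff)
  have "DL (LR (LL \<sigma>)) z = - fst (LR (LL \<sigma>)) * DL (LL \<sigma>) ?w1"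
    using DL_LR_inv[OF f1, of z] p by simp
  then have D1: "0 < DL (LL \<sigma>) ?w1" using assms(4) b1 nu by (simp add: zero_less_mult_iff)
  have "fst z = 1 + snd ?w1 - (\<kappa> * fst ?w1 + \<nu> * fst ?w1)"
    using inv_coords(2)[of z] p by (simp add: algebra_simps)
  then have x1: "(2/5) \<le> fst ?w1" "fst ?w1 \<le> (7/10)"
    using win y1 product_bounds[of "fst ?w1"] unfolding abs_of_pos[OF p] by linarith+
  have "0 < snd ?w1" using upper_line_pos[OF assms(1), of "fst ?w1"] x1 D1 unfolding DL_def by linarith
  then have n: "fst w < 0" by (simp add: snd_pos_iff w_def)
  then have "DL (LL \<sigma>) ?w1 = - fst (LL \<sigma>) * DL \<sigma> w"
    using DL_LL_inv[OF assms(1), of ?w1] unfolding w_def by simp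
  then have "0 < (- fst (LL \<sigma>)) * DL \<sigma> w" using D1 by simp
  moreover have "0 < - fst (LL \<sigma>)" using b2 nu by linarith
  ultimately show "0 < DL \<sigma> w" by (simp only: zero_less_mult_pos)
  have "fst ?w1 = 1 + snd w - (\<kappa> * \<bar>fst w\<bar> + \<nu> * \<bar>fst w\<bar>)"
    using inv_coords(2)[of ?w1] unfolding w_def by (simp add: algebra_simps)
  then have "\<bar>fst w\<bar> \<le> (8/25)" using x1 y product_bounds[of "fst w"] by linarith
  then show "M w" using y n by (intro M_I) linarith+
qed

lemma closure_W_F: "z \<in> closure W \<Longrightarrow> F z \<in> closure W"
proof -
  assume z: "z \<in> closure W"
  have "F ` closure W \<subseteq> closure (F ` W)"
    by (rule image_closure_subset[OF continuous_on_subset[OF cont_F]]) (auto intro: closure_subset[THEN subsetD])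
  moreover have "F ` W \<subseteq> W" using W_F_iff by auto
  ultimately show ?thesis using z closure_mono by blast
qed

text \<open>If z is above all the upper lines it is a limit of W by
  \<open>above_all_closure\<close>. If it is below all the lower ones, the same applies to its
  second preimage, and the closure of W is forward invariant.\<close>

lemma enclosed:
  assumes "z \<in> G" "M z" "z \<notin> closure W"
  obtains \<sigma> \<tau> where "\<sigma> \<in> unst" "\<tau> \<in> unst" "DL \<sigma> z \<le> 0" "0 \<le> DL (LR (LL \<tau>)) z"
proof -
  obtain k where k: "DL ((\<Phi> ^^ k) \<sigma>0) z \<le> 0"
    using above_all_closure[OF assms(1,2)] assms(3) by (meson not_le)
  obtain l where l: "0 \<le> DL (LR (LL ((\<Phi> ^^ l) \<sigma>0))) z"
  proof (rule ccontr)
    assume "\<not> thesis"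
    then have n: "DL (LR (LL ((\<Phi> ^^ l) \<sigma>0))) z < 0" for l using that by (meson not_le)
    note lb = lift_below[OF unst_flat[OF unst_pow] assms(1,2) n]
    have "inv F (inv F z) \<in> closure W" by (rule above_all_closure) (use lb in blast)+
    then have "F (F (inv F (inv F z))) \<in> closure W" using closure_W_F by blast
    then show False using assms(3) by simp
  qed
  from that[OF unst_pow unst_pow k l] show thesis .
qed

section \<open>The maximal invariant set is the closure of the unstable manifold\<close>

text \<open>If the preimage were on the right, the second preimage would be within 1/5 of the
  critical line and lie in the window. So the preimage is on the left; there \<open>gR\<close> is
  not positive, and only a negative \<open>gL\<close> can keep it out of the window.\<close>

lemma leaf_left_backward:
  assumes "w \<in> G" "gL w < 0" "\<not> M (inv F w)" "\<not> M (inv F (inv F w))"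
  shows "fst (inv F w) < 0" "gL (inv F w) < 0"
proof -
  let ?w1 = "inv F w" and ?w2 = "inv F (inv F w)"
  have y: "\<bar>snd w\<bar> \<le> (1/10000)" "\<bar>snd ?w1\<bar> \<le> (1/10000)" "\<bar>snd ?w2\<bar> \<le> (1/10000)"
    using G_bounds(3)[OF assms(1)] G_bounds(3)[OF G_inv1[OF assms(1)]]
      G_bounds(3)[OF G_inv1[OF G_inv1[OF assms(1)]]] nu nu_small by linarith+
  have x: "fst w < -(8/25)" using gL_estimate[of w] assms(2) y by linarith
  show n: "fst ?w1 < 0"
  proof (rule ccontr)
    assume "\<not> fst ?w1 < 0"
    then have p: "0 \<le> fst ?w1" by simp
    have "fst w = 1 + snd ?w1 - (\<kappa> * fst ?w1 + \<nu> * fst ?w1)"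
      using inv_coords(2)[of w] p by (simp add: algebra_simps)
    then have x1: "(13/20) \<le> fst ?w1"
      using x y product_bounds[of "fst ?w1"] unfolding abs_of_nonneg[OF p] by linarith
    have "fst ?w1 = 1 + snd ?w2 - (\<kappa> * \<bar>fst ?w2\<bar> + \<nu> * \<bar>fst ?w2\<bar>)"
      using inv_coords(2)[of ?w1] by (simp add: algebra_simps)
    then have x2: "\<bar>fst ?w2\<bar> \<le> (1/5)"
      using x1 y product_bounds[of "fst ?w2"] by linarith
    have "M ?w2"
    proof (cases "0 \<le> fst ?w2")
      case True
      \<comment> \<open>Both steps are on the right, so \<open>gR\<close> at w2 is \<open>gL\<close>
        at w, which is negative.\<close>
      have "fR (fR ?w2) = w" using F_eq_fR[OF True] F_eq_fR[OF p] by simp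
      then have "gR ?w2 \<le> 0" using assms(2) by (simp add: gR_def)
      moreover have "0 \<le> gL ?w2" using gL_estimate[of ?w2] y x2 True by linarith
      ultimately show ?thesis by (simp add: M_def)
    next
      case False
      then show ?thesis using x2 y by (intro M_I) linarith+
    qed
    then show False using assms(4) by simp
  qed
  have "gR ?w1 \<le> 0"
  proof (rule ccontr)
    assume "\<not> gR ?w1 \<le> 0"
    then show False using gR_estimate[of ?w1] y n by linarith
  qed
  then show "gL ?w1 < 0" using assms(3) by (simp add: M_def)
qed

lemma hh_G_bound:
  assumes "z \<in> G"
  shows "\<bar>hh z - hX\<bar> \<le> 1"
proof -
  note gb = G_bounds[OF assms]
  have "\<bar>fst z\<bar> \<le> 2" using gb(1,2) nu nu_small kappa by linarith
  then have "\<bar>\<nu> * fst z\<bar> \<le> (1/100000) * 2" unfolding abs_mult using nu nu_small by (intro mult_mono) auto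
  then show ?thesis using gb(3) hX_bounds nu nu_small unfolding hh_def by linarith
qed

text \<open>An orbit avoiding the window from time N on cannot pass left of the left leaf, since it
  would then converge backwards to the leaf of the left fixed point. So it stays right of the right
  leaf, hence in the right half plane, and lies in W.\<close>

lemma visits_window:
  assumes "z \<in> G" "z \<notin> W"
  obtains n where "N \<le> n" "M ((inv F ^^ n) z)"
proof (rule ccontr)
  assume "\<not> thesis"
  then have nM: "\<not> M ((inv F ^^ n) z)" if "N \<le> n" for n using that \<open>\<And>n. N \<le> n \<Longrightarrow> M ((inv F ^^ n) z) \<Longrightarrow> thesis\<close> by blast
  have wG: "(inv F ^^ n) z \<in> G" for n by (rule G_inv[OF assms(1)])
  have nleft: "0 \<le> gL ((inv F ^^ n) z)" if n: "N \<le> n" for n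
  proof (rule ccontr)
    assume "\<not> 0 \<le> gL ((inv F ^^ n) z)"
    then have g: "gL ((inv F ^^ (n + k)) z) < 0" for k
    proof (induction k)
      case (Suc k)
      show ?case
        using leaf_left_backward(2)[OF wG[of "n + k"] Suc.IH[OF Suc.prems]] nM[of "n + k + 1"] nM[of "n + k + 2"] n
        by simp
    qed simp
    have neg: "fst ((inv F ^^ Suc (n + k)) z) < 0" for k
      using leaf_left_backward(1)[OF wG[of "n + k"] g[of k]] nM[of "n + k + 1"] nM[of "n + k + 2"] n by simp
    define c where "c = ll ((inv F ^^ n) z) - lY"
    have c: "\<kappa> ^ k * (ll ((inv F ^^ (n + k)) z) - lY) = c" for k
    proof (induction k)
      case (Suc k)
      let ?w = "(inv F ^^ (n + k)) z"
      have "ll ?w = 1 + \<kappa> * ll (inv F ?w)" using ll_inv[of ?w] neg[of k] by simp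
      then have "ll ?w - lY = \<kappa> * (ll (inv F ?w) - lY)" using lY_eq by (simp add: algebra_simps)
      then show ?case using Suc by (simp add: mult_ac)
    qed (simp add: c_def)
    \<comment> \<open>The distance of \<open>ll\<close> to lY shrinks like \<kappa> ^ (-k) and
      eventually violates the fourth bound of \<open>G_bounds\<close>.\<close>
    obtain k where k: "c / (2 - \<kappa>) < \<kappa> ^ k" using real_arch_pow[of \<kappa>] kappa by fastforce
    have "\<kappa> ^ k * (1 * (2 - \<kappa>)) \<le> \<kappa> ^ k * (ll ((inv F ^^ (n + k)) z) - lY)"
      using G_bounds(4)[OF wG[of "n + k"]] kappa by (intro mult_left_mono) auto
    then show False using c[of k] k kappa by (simp add: field_simps)
  qed
  have pos: "0 < fst ((inv F ^^ n) z)" if n: "N \<le> n" for n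
  proof -
    let ?w = "(inv F ^^ n) z"
    have "\<bar>snd ?w\<bar> \<le> (1/10000)" using G_bounds(3)[OF wG[of n]] nu_small by linarith
    moreover have "0 < gR ?w" using nM[OF n] nleft[OF n] by (simp add: M_def)
    ultimately show ?thesis using gR_estimate[of ?w] by linarith
  qed
  let ?w = "(inv F ^^ N) z"
  have add: "(inv F ^^ i) ?w = (inv F ^^ (i + N)) z" for i by (simp add: funpow_add)
  have p: "0 \<le> fst ((inv F ^^ Suc i) ?w)" for i
    using pos[of "Suc i + N"] unfolding add by simp
  have b: "\<bar>hh ((inv F ^^ i) ?w) - hX\<bar> \<le> 1" for i
    using hh_G_bound[OF wG[of "i + N"]] unfolding add .
  have "?w \<in> W" by (rule backward_right_W[OF p backward_right_hh[OF p b]])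
  then show False using assms(2) unfolding W_inv_pow_iff by simp
qed

section \<open>Forward contraction of the stable leaves\<close>

lemma stable_leaf:
  assumes "rr w = rX" "\<bar>hh w\<bar> \<le> 1/2"
  shows "dist ((F ^^ n) w) X \<le> 4 * \<nu> ^ n"
proof -
  have "rr ((F ^^ n) w) = rX \<and> \<bar>hh ((F ^^ n) w)\<bar> \<le> 1/2 \<and> \<bar>hh ((F ^^ n) w) - hX\<bar> \<le> \<nu> ^ n"
  proof (induction n)
    case 0
    then show ?case using assms hX_bounds nu nu_small by simp
  next
    case (Suc n)
    let ?v = "(F ^^ n) w"
    have h: "rr ?v = rX" "\<bar>hh ?v\<bar> \<le> 1/2" "\<bar>hh ?v - hX\<bar> \<le> \<nu> ^ n" using Suc by auto
    have q: "0 < 1 - \<nu> / \<kappa>" using kappa nu nu_small by (simp add: field_simps)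
    have "\<bar>hh ?v\<bar> \<le> (3/10) * \<kappa>" using h(2) kappa by linarith
    then have "\<bar>hh ?v / \<kappa>\<bar> \<le> (3/10)" using kappa by (simp add: abs_divide pos_divide_le_eq)
    \<comment> \<open>The bound 1/2 on \<open>hh\<close> keeps the orbit in the right half plane:
      \<open>rX\<close> > 333/1000 outweighs 3/10.\<close>
    then have "0 < fst ?v * (1 - \<nu> / \<kappa>)" using fst_of_rr_hh[of ?v] h(1) rX_bounds by linarith
    then have p: "0 \<le> fst ?v" using q by (simp add: zero_less_mult_iff)
    have "rr (F ?v) = rX" using rr_F[OF p] rX_eq h(1) by simp
    moreover have hF: "hh (F ?v) = - \<nu> * (1 + hh ?v)" by (rule hh_F[OF p])
    moreover have "\<bar>hh (F ?v)\<bar> \<le> (1/100000) * 2"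
      unfolding hF abs_mult using nu nu_small h(2) by (intro mult_mono) auto
    moreover have "hh (F ?v) - hX = - \<nu> * (hh ?v - hX)" using hF hX_eq by (simp add: algebra_simps)
    then have "\<bar>hh (F ?v) - hX\<bar> \<le> \<nu> * \<nu> ^ n"
      using h(3) nu by (simp add: abs_mult)
    ultimately show ?case by simp
  qed
  then have "\<bar>rr ((F ^^ n) w) - rX\<bar> = 0" "\<bar>hh ((F ^^ n) w) - hX\<bar> \<le> \<nu> ^ n" by auto
  moreover from this have "dist ((F ^^ n) w) X \<le> 4 * \<bar>hh ((F ^^ n) w) - hX\<bar>"
    using dist_X_le[of "(F ^^ n) w"] by simp
  ultimately show ?thesis by (meson mult_left_mono order_trans zero_le_numeral)
qed

lemma kappa_nu_small: "\<kappa> * \<nu> \<le> (1/50000)"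
  using kappa_nu nu_small by linarith

lemma gL_zero_contracts:
  assumes "gL z = 0" "\<bar>fst z\<bar> \<le> 1" "\<bar>snd z\<bar> \<le> (1/100)"
  shows "dist ((F ^^ (n + 1)) z) X \<le> 4 * \<nu> ^ n"
proof -
  have n: "fst z < 0" using gL_estimate[of z] assms by linarith
  then have "rr (F z) = 1 + gL z - \<kappa> / (1 + \<kappa>)"
    using kappa by (simp add: rr_def gL_def algebra_simps)
  also have "\<dots> = rX" using kappa assms(1) by (simp add: rX_def field_simps)
  finally have r: "rr (F z) = rX" .
  have small: "\<bar>\<kappa> * \<nu> * fst z\<bar> \<le> (1/10) * 1"
    unfolding abs_mult[of "\<kappa> * \<nu>"] using assms(2) kappa_nu kappa_nu_small by (intro mult_mono) auto
  have "(\<kappa> + \<nu>) * \<bar>fst z\<bar> \<le> 3 * 1" using assms(2) kappa nu nu_small by (intro mult_mono) auto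
  moreover have "0 \<le> (\<kappa> + \<nu>) * \<bar>fst z\<bar>" using kappa nu by simp
  ultimately have "\<bar>fst (F z)\<bar> \<le> 5" using assms(3) unfolding F_coords by linarith
  then have "\<bar>\<nu> * fst (F z)\<bar> \<le> (1/100000) * 5" unfolding abs_mult using nu nu_small by (intro mult_mono) auto
  moreover have "hh (F z) = - (\<kappa> * \<nu> * fst z) - \<nu> * fst (F z)" by (simp add: hh_def)
  ultimately have "\<bar>hh (F z)\<bar> \<le> 1/2" using small by linarith
  from stable_leaf[OF r this, of n] show ?thesis by (simp add: funpow_swap1)
qed

lemma gR_zero_contracts:
  assumes "gR z = 0" "\<bar>fst z\<bar> \<le> (2/5)" "\<bar>snd z\<bar> \<le> (1/1000)"
  shows "dist ((F ^^ (n + 3)) z) X \<le> 4 * \<nu> ^ n"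
proof -
  have p: "(1/10) \<le> fst z" "fst z \<le> (1/5)" using gR_estimate[of z] assms by linarith+
  then have p0: "0 \<le> fst z" by simp
  have y1: "\<bar>snd (F z)\<bar> \<le> (1/10000) * 1"
    unfolding F_coords abs_mult abs_minus_cancel using p kappa_nu kappa_nu_small by (intro mult_mono) auto
  have "fst (F z) = 1 + snd z - (\<kappa> * fst z + \<nu> * fst z)" using p by (simp add: algebra_simps)
  then have x1: "(1/2) \<le> fst (F z)" "fst (F z) \<le> (9/10)"
    using p assms(3) product_bounds[of "fst z"] unfolding abs_of_nonneg[OF p0] by linarith+
  then have p1: "0 \<le> fst (F z)" by simp
  have y2: "\<bar>snd (F (F z))\<bar> \<le> (1/10000) * 1"
    unfolding F_coords(2)[of "F z"] abs_mult abs_minus_cancel using x1 kappa_nu kappa_nu_small by (intro mult_mono) auto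
  have "fst (F (F z)) = 1 + snd (F z) - (\<kappa> * fst (F z) + \<nu> * fst (F z))"
    unfolding F_coords(1)[of "F z"] abs_of_nonneg[OF p1] by (simp add: algebra_simps)
  then have x2: "\<bar>fst (F (F z))\<bar> \<le> 1"
    using x1 y1 product_bounds[of "fst (F z)"] unfolding abs_of_nonneg[OF p1] by linarith
  have "gL (F (F z)) = 0"
    using assms(1) F_eq_fR[OF p0] F_eq_fR[OF p1] by (simp add: gR_def)
  from gL_zero_contracts[OF this x2, of n] y2 show ?thesis
    by (simp add: funpow_swap1 numeral_3_eq_3)
qed

section \<open>Quadrilaterals between W and the leaves, and the area argument\<close>

definition Quad :: "real \<times> real \<Rightarrow> real \<times> real \<Rightarrow> (real \<times> real) set" where
  "Quad \<sigma> \<tau> = {z. 0 \<le> gL z \<and> gR z \<le> 0 \<and> DL \<sigma> z \<le> 0 \<and> 0 \<le> DL \<tau> z}"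

lemma continuous_functionals:
  "continuous_on A gL" "continuous_on A gR" "continuous_on A (DL \<sigma>)"
  unfolding gL_def gR_def fR_def DL_def by (intro continuous_intros)+

lemma closed_Quad: "closed (Quad \<sigma> \<tau>)"
  unfolding Quad_def by (intro closed_Collect_conj closed_Collect_le continuous_functionals continuous_intros)

lemma frontier_Quad:
  assumes "z \<in> frontier (Quad \<sigma> \<tau>)"
  shows "z \<in> Quad \<sigma> \<tau>" "gL z = 0 \<or> gR z = 0 \<or> DL \<sigma> z = 0 \<or> DL \<tau> z = 0"
proof -
  show z: "z \<in> Quad \<sigma> \<tau>" using assms closed_Quad by (simp add: frontier_def)
  have "open {z. 0 < gL z \<and> gR z < 0 \<and> DL \<sigma> z < 0 \<and> 0 < DL \<tau> z}" (is "open ?I")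
    by (intro open_Collect_conj open_Collect_less continuous_functionals continuous_intros)
  moreover have "?I \<subseteq> Quad \<sigma> \<tau>" by (auto simp: Quad_def)
  ultimately have "?I \<subseteq> interior (Quad \<sigma> \<tau>)" by (rule interior_maximal[rotated])
  moreover have "z \<notin> interior (Quad \<sigma> \<tau>)" using assms by (simp add: frontier_def)
  ultimately have "\<not> (0 < gL z \<and> gR z < 0 \<and> DL \<sigma> z < 0 \<and> 0 < DL \<tau> z)" by blast
  then show "gL z = 0 \<or> gR z = 0 \<or> DL \<sigma> z = 0 \<or> DL \<tau> z = 0"
    using z unfolding Quad_def by (simp, linarith)
qed

lemma Quad_bounds:
  assumes "flat \<sigma>" "flat \<tau>" "z \<in> Quad \<sigma> \<tau>"
  shows "-(17/50) < fst z" "fst z < (9/50)" "\<bar>snd z\<bar> \<le> (1/1000)"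
proof -
  have s: "\<bar>snd \<sigma>\<bar> \<le> (1/10000)" "\<bar>snd \<tau>\<bar> \<le> (1/10000)"
    using assms(1,2) nu_small unfolding flat_def by linarith+
  have "snd z \<le> fst \<sigma> * fst z + snd \<sigma>" "fst \<tau> * fst z + snd \<tau> \<le> snd z"
    using assms(3) unfolding Quad_def DL_def by auto
  then have y: "\<bar>snd z\<bar> \<le> (1/50000) * \<bar>fst z\<bar> + (1/10000)"
    using flat_abs_le[OF assms(1), of "fst z"] flat_abs_le[OF assms(2), of "fst z"]
      product_bounds(1)[of "fst z"] s by linarith
  then have "\<bar>snd z\<bar> \<le> (1/1000) * (1 + \<bar>fst z\<bar>)" unfolding distrib_left by linarith
  moreover have "M z" using assms(3) by (simp add: Quad_def M_def)
  ultimately show "-(17/50) < fst z" "fst z < (9/50)" using M_bounds by blast+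
  then show "\<bar>snd z\<bar> \<le> (1/1000)" using y by linarith
qed

lemma emeasure_F_pow:
  assumes "compact S"
  shows "compact ((F ^^ n) ` S) \<and> emeasure lborel ((F ^^ n) ` S) = ennreal ((\<kappa> * \<nu>) ^ n) * emeasure lborel S"
proof (induction n)
  case 0
  show ?case using assms by simp
next
  case (Suc n)
  let ?T = "(F ^^ n) ` S"
  have eq: "(F ^^ Suc n) ` S = F ` ?T" by (simp add: image_comp)
  have c: "compact ?T" using Suc by blast
  then have "compact (F ` ?T)"
    using compact_continuous_image continuous_on_subset[OF cont_F] by blast
  moreover have "emeasure lborel (F ` ?T) = ennreal (\<kappa> * \<nu>) * emeasure lborel ?T"
    using emeasure_lozi_image[of "- (\<kappa> * \<nu>)" ?T "\<kappa> + \<nu>"] c kappa nu unfolding F_def[symmetric] by simp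
  ultimately show ?case
    using Suc ennreal_mult[of "\<kappa> * \<nu>" "(\<kappa> * \<nu>) ^ n"] kappa_nu(3) unfolding eq power_Suc
    by (simp only: mult.assoc zero_le_power less_imp_le simp_thms)
qed

lemma G_subset_closure_W: "G \<subseteq> closure W"
proof
  fix z assume zG: "z \<in> G"
  show "z \<in> closure W"
  proof (rule ccontr)
    assume zn: "z \<notin> closure W"
    then obtain e where e: "0 < e" "\<And>w. w \<in> W \<Longrightarrow> e \<le> dist w z"
      unfolding closure_approachable by (meson not_le)
    \<comment> \<open>Half the distance e keeps B both off W and at distance at least e/2 from X,
      which itself belongs to W.\<close>
    define B where "B = cball z (e / 2)"
    have BW: "w \<notin> W" if "w \<in> B" for w
    proof
      assume "w \<in> W"
      then have "e \<le> dist z w" using e(2) by (simp add: dist_commute)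
      then show False using that e(1) by (simp add: B_def)
    qed
    have BX: "e / 2 \<le> dist w X" if "w \<in> B" for w
      using e(2)[OF X_in_W] that dist_triangle[of X z w] by (simp add: B_def dist_commute)
    define K where "K = (cbox (-1, -1) (1, 1) :: (real \<times> real) set)"
    define \<beta> where "\<beta> = unit_ball_vol (real (DIM(real \<times> real))) * (e / 2) ^ DIM(real \<times> real)"
    have \<beta>: "0 < \<beta>" "emeasure lborel B = ennreal \<beta>"
      using emeasure_cball[of "e/2" z] e(1) by (simp_all add: B_def \<beta>_def del: DIM_prod)
    define \<gamma> where "\<gamma> = measure lborel K"
    have \<gamma>: "0 \<le> \<gamma>" "emeasure lborel K = ennreal \<gamma>"
      using emeasure_eq_ennreal_measure[of lborel K] emeasure_lborel_cbox_finite[of "(-1, -1)" "(1, 1) :: real \<times> real"]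
      by (simp_all add: \<gamma>_def K_def)
    have "(\<lambda>n. (\<kappa> * \<nu>) ^ n * \<gamma>) \<longlonglongrightarrow> 0"
      using kappa_nu kappa_nu_small by (intro tendsto_mult_left_zero LIMSEQ_realpow_zero) auto
    then have "\<forall>\<^sub>F n in sequentially. (\<kappa> * \<nu>) ^ n * \<gamma> < \<beta>" using \<beta>(1) by (rule order_tendstoD(2))
    then obtain N1 where N1: "\<And>n. N1 \<le> n \<Longrightarrow> (\<kappa> * \<nu>) ^ n * \<gamma> < \<beta>" by (auto simp: eventually_sequentially)
    have "(\<lambda>n. 4 * \<nu> ^ n) \<longlonglongrightarrow> 0"
      using nu nu_small by (intro tendsto_mult_right_zero LIMSEQ_realpow_zero) auto
    then have "\<forall>\<^sub>F n in sequentially. 4 * \<nu> ^ n < e / 2" by (rule order_tendstoD(2)) (use e(1) in simp)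
    then obtain N2 where N2: "\<And>n. N2 \<le> n \<Longrightarrow> 4 * \<nu> ^ n < e / 2" by (auto simp: eventually_sequentially)
    have "z \<notin> W" using zn closure_subset by blast
    \<comment> \<open>N1 serves the area comparison and N2 the contraction; the 3 pays for the steps
      that bring the sides of the window onto the local stable manifold.\<close>
    then obtain n where n: "N1 + N2 + 3 \<le> n" "M ((inv F ^^ n) z)" using visits_window[OF zG] by blast
    let ?w = "(inv F ^^ n) z"
    have "?w \<notin> closure W"
    proof
      assume "?w \<in> closure W"
      then have "(F ^^ k) ?w \<in> closure W" for k by (induction k) (auto intro: closure_W_F)
      then have "(F ^^ n) ?w \<in> closure W" .
      then show False using zn by (simp add: funpow_inv_cancel[OF bij_F])
    qed
    then obtain \<sigma> \<tau> where st: "\<sigma> \<in> unst" "\<tau> \<in> unst" "DL \<sigma> ?w \<le> 0" "0 \<le> DL (LR (LL \<tau>)) ?w"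
      using enclosed[OF G_inv[OF zG] n(2)] by blast
    let ?b = "LR (LL \<tau>)"
    have ub: "?b \<in> unst" by (rule unst_LR_LL[OF st(2)])
    note Qb = Quad_bounds[OF unst_flat[OF st(1)] unst_flat[OF ub]]
    define S where "S = (inv F ^^ n) ` B"
    have FS: "(F ^^ n) ` S = B" by (simp add: S_def image_comp comp_def funpow_inv_cancel[OF bij_F])
    have cont: "continuous_on UNIV (inv F ^^ k)" for k
    proof (induction k)
      case (Suc k)
      show ?case using continuous_on_compose[OF Suc continuous_on_subset[OF cont_invF]] by simp
    qed (simp add: id_def)
    have S: "compact S" "connected S"
      unfolding S_def B_def using continuous_on_subset[OF cont]
      by (auto intro!: compact_continuous_image connected_continuous_image)
    have wS: "?w \<in> S" using e(1) by (auto simp: S_def B_def)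
    have wQ: "?w \<in> Quad \<sigma> ?b" using st n(2) by (simp add: Quad_def M_def)
    \<comment> \<open>Otherwise S would have at most the area of K, and its n-th image B, whose area
      is smaller by the factor (\<kappa>\<nu>)^n, would be too small.\<close>
    have "\<not> S \<subseteq> Quad \<sigma> ?b"
    proof
      assume sub: "S \<subseteq> Quad \<sigma> ?b"
      have "S \<subseteq> K"
      proof
        fix p assume "p \<in> S"
        then have "p \<in> Quad \<sigma> ?b" using sub by blast
        from Qb[OF this] show "p \<in> K" unfolding K_def by (cases p) (auto simp: cbox_Pair_eq)
      qed
      then have "emeasure lborel S \<le> ennreal \<gamma>"
        unfolding \<gamma>(2)[symmetric] by (intro emeasure_mono) (auto simp: K_def)
      then have "ennreal ((\<kappa> * \<nu>) ^ n) * emeasure lborel S \<le> ennreal ((\<kappa> * \<nu>) ^ n) * ennreal \<gamma>"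
        by (rule mult_left_mono) simp
      also have "\<dots> = ennreal ((\<kappa> * \<nu>) ^ n * \<gamma>)" using \<gamma>(1) kappa_nu(3) by (simp add: ennreal_mult)
      also have "\<dots> < ennreal \<beta>" using N1[of n] n(1) \<beta>(1) by (intro ennreal_lessI) auto
      finally show False
        using emeasure_F_pow[OF S(1), of n] \<beta>(2) unfolding FS by simp
    qed
    then have "S \<inter> frontier (Quad \<sigma> ?b) \<noteq> {}"
      using connected_Int_frontier[OF S(2)] wS wQ by blast
    then obtain p where p: "p \<in> S" "p \<in> frontier (Quad \<sigma> ?b)" by blast
    have pB: "(F ^^ n) p \<in> B" using p(1) FS by blast
    have pW: "p \<notin> W"
      using BW[OF pB] W_inv_pow_iff[of n "(F ^^ n) p"] by (simp add: funpow_inv_cancel[OF bij_F])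
    note pq = Qb[OF frontier_Quad(1)[OF p(2)]]
    \<comment> \<open>The upper and lower sides lie in W, which B and its preimages avoid. So p is
      on a leaf and its n-th image is too close to X to be in B.\<close>
    have "DL \<sigma> p \<noteq> 0" "DL ?b p \<noteq> 0"
      using unst_point[OF st(1)] unst_point[OF ub] pq pW by (meson less_imp_le)+
    then consider "gL p = 0" | "gR p = 0" using frontier_Quad(2)[OF p(2)] by blast
    then have "dist ((F ^^ n) p) X < e / 2"
    proof cases
      case 1
      have "\<bar>fst p\<bar> \<le> 1" "\<bar>snd p\<bar> \<le> (1/100)" using pq by auto
      note c = gL_zero_contracts[OF 1 this, of "n - 1"]
      have "N2 \<le> n - 1" "n - 1 + 1 = n" using n(1) by auto
      then show ?thesis using N2[of "n - 1"] c by (metis order.strict_trans1)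
    next
      case 2
      have "\<bar>fst p\<bar> \<le> (2/5)" "\<bar>snd p\<bar> \<le> (1/1000)" using pq by auto
      note c = gR_zero_contracts[OF 2 this, of "n - 3"]
      have "N2 \<le> n - 3" "n - 3 + 3 = n" using n(1) by auto
      then show ?thesis using N2[of "n - 3"] c by (metis order.strict_trans1)
    qed
    then show False using BX[OF pB] by simp
  qed
qed

lemma G_eq: "G = closure W"
proof
  have "compact G" unfolding G_def by (rule compact_max_inv[OF bij_F trapping_U bounded_U cont_invF])
  then show "closure W \<subseteq> G" by (intro closure_minimal W_subset_G compact_imp_closed)
qed (rule G_subset_closure_W)

lemma strange_attractor_F: "strange_attractor F (closure W)"
proof -
  have "compact G" unfolding G_def by (rule compact_max_inv[OF bij_F trapping_U bounded_U cont_invF])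
  moreover have "F ` G = G" unfolding G_def by (rule max_inv_image[OF bij_F trapping_U])
  moreover have "maximal_in F U G"
    using calculation trapping_U max_inv_eq[OF bij_F] max_inv_subset unfolding maximal_in_def G_def by blast
  ultimately show ?thesis unfolding strange_attractor_def G_eq[symmetric] by blast
qed

section \<open>Descriptions of G and W that pass to limits of parameters\<close>

lemma G_Ubar: "G = {z. \<forall>n. (inv F ^^ n) z \<in> Ubar}"
proof (intro equalityI subsetI)
  fix z assume "z \<in> G"
  then show "z \<in> {z. \<forall>n. (inv F ^^ n) z \<in> Ubar}"
    using U_subset_Ubar unfolding G_def max_inv_def by blast
next
  fix z assume z: "z \<in> {z. \<forall>n. (inv F ^^ n) z \<in> Ubar}"
  have "(inv F ^^ n) z \<in> U" for n
  proof -
    have "(inv F ^^ Suc n) z \<in> Ubar" using z by blast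
    then have "F ((inv F ^^ Suc n) z) \<in> U" by (rule F_Ubar_U)
    then show ?thesis by simp
  qed
  then show "z \<in> G" by (simp add: G_def max_inv_def)
qed

text \<open>The vector (1, \<nu>) is the unstable direction at X. The length 1/20 is the same for
  all parameters, so fixed n and t name a point of W for each of them.\<close>

lemma unstable_segment_in_W:
  assumes "\<bar>t\<bar> \<le> 1/20"
  shows "(F ^^ n) (X + (t, t * \<nu>)) \<in> W"
proof -
  let ?p = "X + (t, t * \<nu>)"
  have "hh ?p = hX" using X_coords(4) by (simp add: hh_def algebra_simps)
  moreover have "rr ?p = rX + t * (1 - \<nu> / \<kappa>)"
    using X_coords(3) by (simp add: rr_def algebra_simps add_divide_distrib)
  moreover have "\<bar>t * (1 - \<nu> / \<kappa>)\<bar> \<le> 1/20 * 1"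
    unfolding abs_mult using assms kappa nu nu_small by (intro mult_mono) auto
  ultimately have "?p \<in> W" using rX_bounds by (intro unstable_line_in_W) linarith+
  then show ?thesis using W_inv_pow_iff[of n "(F ^^ n) ?p"] by (simp add: funpow_inv_cancel[OF bij_F])
qed

text \<open>Far enough back, the orbit is near X and stays in the right half plane;
  \<open>backward_right_hh\<close> then puts it on the unstable line.\<close>

lemma W_unstable_segment:
  assumes "w \<in> W"
  obtains n t where "\<bar>t\<bar> \<le> 1/20" "w = (F ^^ n) (X + (t, t * \<nu>))"
proof -
  have lim: "(\<lambda>n. (inv F ^^ n) w) \<longlonglongrightarrow> X" using assms by (simp add: W_iff)
  have "(\<lambda>n. rr ((inv F ^^ n) w)) \<longlonglongrightarrow> rX"
    unfolding rr_def X_coords(3)[symmetric, unfolded rr_def] using kappa by (intro tendsto_intros lim) auto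
  then have "\<forall>\<^sub>F n in sequentially. dist (rr ((inv F ^^ n) w)) rX < 1/25" by (rule tendstoD) simp
  moreover have "(\<lambda>n. fst ((inv F ^^ n) w)) \<longlonglongrightarrow> fst X" by (intro tendsto_intros lim)
  then have "\<forall>\<^sub>F n in sequentially. 0 < fst ((inv F ^^ n) w)"
    by (rule order_tendstoD(1)) (use X_coords in linarith)
  ultimately have "\<forall>\<^sub>F n in sequentially. dist (rr ((inv F ^^ n) w)) rX < 1/25 \<and> 0 < fst ((inv F ^^ n) w)"
    by (rule eventually_conj)
  then obtain N where N: "\<And>n. N \<le> n \<Longrightarrow> \<bar>rr ((inv F ^^ n) w) - rX\<bar> < 1/25"
    "\<And>n. N \<le> n \<Longrightarrow> 0 < fst ((inv F ^^ n) w)"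
    by (auto simp: eventually_sequentially dist_real_def)
  let ?v = "(inv F ^^ N) w"
  have add: "(inv F ^^ i) ?v = (inv F ^^ (i + N)) w" for i by (simp add: funpow_add)
  have wG: "(inv F ^^ n) w \<in> G" for n using assms W_subset_G G_inv by blast
  have p: "0 \<le> fst ((inv F ^^ Suc i) ?v)" for i unfolding add using N(2)[of "Suc i + N"] by simp
  have "\<bar>hh ((inv F ^^ i) ?v) - hX\<bar> \<le> 1" for i unfolding add by (rule hh_G_bound[OF wG])
  then have h: "hh ?v = hX" using backward_right_hh[OF p] by blast
  define t where "t = fst ?v - fst X"
  have v: "?v = X + (t, t * \<nu>)"
    using h X_coords(4) by (simp add: prod_eq_iff t_def hh_def algebra_simps)
  have "t * (1 - \<nu> / \<kappa>) = rr ?v - rX"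
    using fst_of_rr_hh[of ?v] fst_of_rr_hh[of X] h X_coords unfolding t_def by (simp add: left_diff_distrib)
  then have "\<bar>t\<bar> * (1 - \<nu> / \<kappa>) < 1/25"
    using N(1)[of N] kappa nu nu_small abs_mult[of t "1 - \<nu> / \<kappa>"] by simp
  moreover have "\<bar>t\<bar> * (9/10) \<le> \<bar>t\<bar> * (1 - \<nu> / \<kappa>)"
    using kappa nu nu_small by (intro mult_left_mono) (auto simp: field_simps)
  ultimately have "\<bar>t\<bar> \<le> 1/20" by linarith
  moreover have "w = (F ^^ N) (X + (t, t * \<nu>))"
    unfolding v[symmetric] by (simp add: funpow_inv_cancel[OF bij_F])
  ultimately show thesis by (rule that)
qed

end

section \<open>Dependence on the parameters\<close>

text \<open>\<open>kap\<close> and \<open>nup\<close> are the roots of t^2 = a t + b, the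
  eigenvalues of the left branch.\<close>

definition kap :: "real \<times> real \<Rightarrow> real" where
  "kap p = (fst p + sqrt ((fst p)\<^sup>2 + 4 * snd p)) / 2"
definition nup :: "real \<times> real \<Rightarrow> real" where
  "nup p = (fst p - sqrt ((fst p)\<^sup>2 + 4 * snd p)) / 2"

text \<open>The locale conditions in terms of (a, b). Positivity of \<open>nup\<close> is encoded by
  b < 0 together with the lower bound on \<open>kap\<close>.\<close>

definition tent_params :: "nat \<Rightarrow> (real \<times> real) set" where
  "tent_params m = {p. snd p < 0 \<and> 0 < (fst p)\<^sup>2 + 4 * snd p \<and> 199/100 < kap p \<and> kap p < 2 \<and>
     1000 * nup p < 2 - kap p \<and> 63/100 < kap p ^ (m + 1) * (2 - kap p) \<and>
     kap p ^ (m + 1) * (2 - kap p) < 16/25}"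

lemma kap_nup:
  assumes "0 \<le> (fst p)\<^sup>2 + 4 * snd p"
  shows "kap p + nup p = fst p" "kap p * nup p = - snd p"
proof -
  show "kap p + nup p = fst p" by (simp add: kap_def nup_def field_simps)
  have "(fst p + sqrt ((fst p)\<^sup>2 + 4 * snd p)) * (fst p - sqrt ((fst p)\<^sup>2 + 4 * snd p)) = - 4 * snd p"
    using assms by (simp add: square_diff_square_factored[symmetric] flip: power2_eq_square)
  then show "kap p * nup p = - snd p" by (simp add: kap_def nup_def)
qed

text \<open>On negative arguments \<open>sqrt\<close> is extended as an odd function, so continuity
  holds on the whole plane, even where the discriminant is negative.\<close>

lemma continuous_kap: "continuous_on UNIV kap" "continuous_on UNIV nup"
  unfolding kap_def nup_def by (intro continuous_intros; simp)+

lemma open_tent_params: "open (tent_params m)"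
  unfolding tent_params_def
  by (intro open_Collect_conj open_Collect_less continuous_intros continuous_kap)

lemma tent_paramsD:
  assumes "p \<in> tent_params m"
  shows "lozi_tent (kap p) (nup p) m" "kap p + nup p = fst p" "- (kap p * nup p) = snd p"
proof -
  have s: "0 \<le> (fst p)\<^sup>2 + 4 * snd p" using assms by (simp add: tent_params_def)
  from kap_nup[OF s] show k: "kap p + nup p = fst p" "- (kap p * nup p) = snd p" by simp_all
  have "0 < kap p * nup p" "0 < kap p" using assms k by (auto simp: tent_params_def)
  then have "0 < nup p" by (simp add: zero_less_mult_iff)
  then show "lozi_tent (kap p) (nup p) m" using assms by unfold_locales (auto simp: tent_params_def)
qed

lemma attractor_facts:
  assumes "p \<in> tent_params m"
  shows "lozi_tent.F (kap p) (nup p) = lozi p"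
    and "lozi_tent.X (kap p) (nup p) = lozi_fixed_point p"
    and "closure (lozi_tent.W (kap p) (nup p)) = lozi_attractor p"
    and "lozi_tent.G (kap p) (nup p) = lozi_attractor p"
proof -
  note d = tent_paramsD[OF assms]
  interpret lozi_tent "kap p" "nup p" m by (rule d(1))
  show 1: "F = lozi p" unfolding F_def d by simp
  show 2: "X = lozi_fixed_point p" unfolding X_def d by simp
  show 3: "closure W = lozi_attractor p" unfolding W_def 1 2 lozi_attractor_def by simp
  show "G = lozi_attractor p" using G_eq 3 by simp
qed

lemma lozi_attractor_strange: "p \<in> tent_params m \<Longrightarrow> strange_attractor (lozi p) (lozi_attractor p)"
  using lozi_tent.strange_attractor_F[OF tent_paramsD(1)] attractor_facts by metis

lemma lozi_attractor_compact:
  assumes "p \<in> tent_params m"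
  shows "compact (lozi_attractor p)" "lozi_attractor p \<noteq> {}" "lozi_attractor p \<subseteq> cbox (-2, -2) (2, 2)"
proof -
  interpret lozi_tent "kap p" "nup p" m by (rule tent_paramsD(1)[OF assms])
  show "compact (lozi_attractor p)"
    using lozi_attractor_strange[OF assms] by (simp add: strange_attractor_def)
  show "lozi_attractor p \<noteq> {}"
    unfolding attractor_facts(3)[OF assms, symmetric] using X_in_W closure_subset by blast
  show "lozi_attractor p \<subseteq> cbox (-2, -2) (2, 2)"
  proof
    fix z assume "z \<in> lozi_attractor p"
    then have "z \<in> Ubar" unfolding attractor_facts(4)[OF assms, symmetric] G_Ubar by (metis (mono_tags) funpow_0 mem_Collect_eq)
    then show "z \<in> cbox (-2, -2) (2, 2)"
      using kappa nu nu_small by (cases z) (auto simp: Ubar_def cbox_Pair_eq)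
  qed
qed

section \<open>Upper and lower semicontinuity of the attractor\<close>

definition lozi_inv :: "real \<times> real \<Rightarrow> real \<times> real \<Rightarrow> real \<times> real" where
  "lozi_inv p z = (snd z / snd p, fst z - 1 + fst p * \<bar>snd z / snd p\<bar>)"

lemma inv_lozi: 
  assumes "snd p \<noteq> 0"
  shows "inv (lozi p) = lozi_inv p"
proof (rule inv_equality)
  show "lozi_inv p (lozi p z) = z" "lozi p (lozi_inv p z) = z" for z
    using assms by (simp_all add: lozi_def lozi_inv_def case_prod_beta abs_mult)
qed

lemma tendsto_lozi_inv_pow:
  assumes "(q \<longlongrightarrow> p) T" "snd p \<noteq> 0" "(z \<longlongrightarrow> w) T"
  shows "((\<lambda>i. (lozi_inv (q i) ^^ n) (z i)) \<longlongrightarrow> (lozi_inv p ^^ n) w) T"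
proof (induction n)
  case (Suc n)
  have "((\<lambda>i. lozi_inv (q i) (z i)) \<longlongrightarrow> lozi_inv p w) T" if "(z \<longlongrightarrow> w) T" for z w
    unfolding lozi_inv_def by (intro tendsto_intros assms(1,2) that)
  from this[OF Suc] show ?case by simp
qed (simp add: assms(3))

lemma tendsto_lozi_pow:
  assumes "(q \<longlongrightarrow> p) T" "(z \<longlongrightarrow> w) T"
  shows "((\<lambda>i. (lozi (q i) ^^ n) (z i)) \<longlongrightarrow> (lozi p ^^ n) w) T"
proof (induction n)
  case (Suc n)
  have "((\<lambda>i. lozi (q i) (z i)) \<longlongrightarrow> lozi p w) T" if "(z \<longlongrightarrow> w) T" for z w
    unfolding lozi_def case_prod_beta by (intro tendsto_intros assms(1) that)
  from this[OF Suc] show ?case by simp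
qed (simp add: assms(2))

definition Box :: "real \<times> real \<Rightarrow> (real \<times> real) set" where
  "Box p = {z. - kap p / 2 \<le> fst z \<and> fst z \<le> 1 + 4 * nup p \<and> - 3 * nup p \<le> snd z \<and> snd z \<le> 3 * nup p}"

lemma attractor_Box:
  assumes "p \<in> tent_params m"
  shows "lozi_attractor p = {z. \<forall>n. (lozi_inv p ^^ n) z \<in> Box p}"
proof -
  interpret lozi_tent "kap p" "nup p" m by (rule tent_paramsD(1)[OF assms])
  have "snd p \<noteq> 0" using assms by (auto simp: tent_params_def)
  then have "inv F = lozi_inv p" using inv_lozi attractor_facts(1)[OF assms] by metis
  moreover have "Ubar = Box p" by (simp add: Ubar_def Box_def)
  ultimately show ?thesis
    using G_Ubar attractor_facts(4)[OF assms] by simp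
qed

text \<open>Membership means that all backward iterates satisfy closed inequalities which depend
  continuously on the parameters, so it survives limits. The return time may vary along the
  sequence.\<close>

lemma attractor_limit:
  assumes "\<And>i. q i \<in> (\<Union>m. tent_params m)" "q \<longlonglongrightarrow> p" "p \<in> tent_params m"
    and "\<And>i. z i \<in> lozi_attractor (q i)" "z \<longlonglongrightarrow> w"
  shows "w \<in> lozi_attractor p"
proof -
  have s: "snd p \<noteq> 0" using assms(3) by (auto simp: tent_params_def)
  have lk: "(\<lambda>i. kap (q i)) \<longlonglongrightarrow> kap p" "(\<lambda>i. nup (q i)) \<longlonglongrightarrow> nup p"
    by (rule continuous_on_tendsto_compose[OF continuous_kap(1) assms(2)]; simp)
      (rule continuous_on_tendsto_compose[OF continuous_kap(2) assms(2)]; simp)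
  have "(lozi_inv p ^^ n) w \<in> Box p" for n
  proof -
    let ?v = "\<lambda>i. (lozi_inv (q i) ^^ n) (z i)"
    have lim: "?v \<longlonglongrightarrow> (lozi_inv p ^^ n) w" by (rule tendsto_lozi_inv_pow[OF assms(2) s assms(5)])
    have b: "?v i \<in> Box (q i)" for i
    proof -
      obtain k where "q i \<in> tent_params k" using assms(1) by blast
      from attractor_Box[OF this] show ?thesis using assms(4)[of i] by blast
    qed
    have le: "x \<le> y" if "f \<longlonglongrightarrow> x" "g \<longlonglongrightarrow> y" "\<And>i. f i \<le> g i" for f g :: "nat \<Rightarrow> real" and x y
      using that LIMSEQ_le by blast
    have "- kap p / 2 \<le> fst ((lozi_inv p ^^ n) w)"
      by (rule le[of "\<lambda>i. - kap (q i) / 2" _ "\<lambda>i. fst (?v i)"]) ((intro tendsto_intros lk lim; simp)+, use b in \<open>simp add: Box_def\<close>)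
    moreover have "fst ((lozi_inv p ^^ n) w) \<le> 1 + 4 * nup p"
      by (rule le[of "\<lambda>i. fst (?v i)" _ "\<lambda>i. 1 + 4 * nup (q i)"]) ((intro tendsto_intros lk lim; simp)+, use b in \<open>simp add: Box_def\<close>)
    moreover have "- 3 * nup p \<le> snd ((lozi_inv p ^^ n) w)"
      by (rule le[of "\<lambda>i. - 3 * nup (q i)" _ "\<lambda>i. snd (?v i)"]) ((intro tendsto_intros lk lim; simp)+, use b in \<open>simp add: Box_def\<close>)
    moreover have "snd ((lozi_inv p ^^ n) w) \<le> 3 * nup p"
      by (rule le[of "\<lambda>i. snd (?v i)" _ "\<lambda>i. 3 * nup (q i)"]) ((intro tendsto_intros lk lim; simp)+, use b in \<open>simp add: Box_def\<close>)
    ultimately show ?thesis by (simp add: Box_def)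
  qed
  then show ?thesis using attractor_Box[OF assms(3)] by blast
qed

text \<open>If it failed, points of nearby attractors at distance more than e would accumulate in
  the common box, and by \<open>attractor_limit\<close> at a point of the limit attractor.\<close>

lemma attractor_upper:
  assumes p: "p \<in> tent_params m" and e: "0 < e"
  shows "\<forall>\<^sub>F q in at p within (\<Union>m. tent_params m). \<forall>z\<in>lozi_attractor q. \<exists>w\<in>lozi_attractor p. dist z w \<le> e"
proof (rule sequentially_imp_eventually_within, intro allI impI)
  fix f assume f: "(\<forall>n. f n \<in> (\<Union>m. tent_params m) \<and> f n \<noteq> p) \<and> f \<longlonglongrightarrow> p"
  show "\<forall>\<^sub>F n in sequentially. \<forall>z\<in>lozi_attractor (f n). \<exists>w\<in>lozi_attractor p. dist z w \<le> e"
  proof (rule ccontr)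
    assume "\<not> ?thesis"
    from not_eventually_sequentiallyD[OF this] obtain r :: "nat \<Rightarrow> nat" where r: "strict_mono r"
      "\<forall>n. \<not> (\<forall>z\<in>lozi_attractor (f (r n)). \<exists>w\<in>lozi_attractor p. dist z w \<le> e)"
      by blast
    have "\<forall>n. \<exists>z. z \<in> lozi_attractor (f (r n)) \<and> (\<forall>w\<in>lozi_attractor p. e < dist z w)"
      using r(2) unfolding not_le[symmetric] by blast
    from choice[OF this] obtain z where
      "\<forall>n. z n \<in> lozi_attractor (f (r n)) \<and> (\<forall>w\<in>lozi_attractor p. e < dist (z n) w)" ..
    then have z: "\<And>n. z n \<in> lozi_attractor (f (r n))" "\<And>n w. w \<in> lozi_attractor p \<Longrightarrow> e < dist (z n) w"
      by blast+
    have "z n \<in> cbox (-2, -2) (2, 2)" for n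
      using z(1)[of n] f lozi_attractor_compact(3) by blast
    then obtain w and s :: "nat \<Rightarrow> nat" where ws: "strict_mono s" "(z \<circ> s) \<longlonglongrightarrow> w"
      using compact_cbox[of "(-2, -2)" "(2, 2) :: real \<times> real"] unfolding compact_def by blast
    have "w \<in> lozi_attractor p"
    proof (rule attractor_limit[OF _ _ p])
      show "f (r (s i)) \<in> (\<Union>m. tent_params m)" for i using f by blast
      have "strict_mono (r \<circ> s)" using r(1) ws(1) by (rule strict_mono_o)
      then show "(\<lambda>i. f (r (s i))) \<longlonglongrightarrow> p" using LIMSEQ_subseq_LIMSEQ[of f p "r \<circ> s"] f by (simp add: comp_def)
      show "z (s i) \<in> lozi_attractor (f (r (s i)))" for i by (rule z(1))
      show "(\<lambda>i. z (s i)) \<longlonglongrightarrow> w" using ws(2) by (simp add: comp_def)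
    qed
    moreover have "\<forall>\<^sub>F i in sequentially. dist ((z \<circ> s) i) w < e" using ws(2) e by (rule tendstoD)
    then obtain i where "dist (z (s i)) w < e" by (auto simp: eventually_sequentially)
    ultimately show False using z(2)[of w "s i"] by simp
  qed
qed

text \<open>Write w as an iterate of a point of the unstable segment. The same expression in n and t
  at q gives a point of the attractor of q that varies continuously with q.\<close>

lemma attractor_lower_point:
  assumes p: "p \<in> tent_params m" and w: "w \<in> lozi_tent.W (kap p) (nup p)" and e: "0 < e"
  shows "\<forall>\<^sub>F q in at p within (\<Union>m. tent_params m). \<exists>w'\<in>lozi_attractor q. dist w' w < e"
proof -
  interpret lozi_tent "kap p" "nup p" m by (rule tent_paramsD(1)[OF p])
  obtain n t where t: "\<bar>t\<bar> \<le> 1/20" "w = (F ^^ n) (X + (t, t * nup p))"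
    using W_unstable_segment[OF w] by blast
  let ?g = "\<lambda>q. (lozi q ^^ n) (lozi_fixed_point q + (t, t * nup q))"
  have "1 + fst p - snd p \<noteq> 0"
    using tent_paramsD(2,3)[OF p] kappa nu kappa_nu by linarith
  then have "((\<lambda>q. lozi_fixed_point q) \<longlongrightarrow> lozi_fixed_point p) (at p within (\<Union>m. tent_params m))"
    unfolding lozi_fixed_point_def case_prod_beta by (intro tendsto_intros)
  moreover have "(nup \<longlongrightarrow> nup p) (at p within (\<Union>m. tent_params m))"
    using continuous_kap(2) by (metis UNIV_I continuous_on_def tendsto_within_subset subset_UNIV)
  ultimately have "(?g \<longlongrightarrow> (lozi p ^^ n) (lozi_fixed_point p + (t, t * nup p))) (at p within (\<Union>m. tent_params m))"
    by (intro tendsto_lozi_pow tendsto_intros)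
  then have "\<forall>\<^sub>F q in at p within (\<Union>m. tent_params m). dist (?g q) w < e"
    using e t(2) attractor_facts(1,2)[OF p] tendstoD by fastforce
  moreover have "?g q \<in> lozi_attractor q" if q: "q \<in> (\<Union>m. tent_params m)" for q
  proof -
    obtain k where k: "q \<in> tent_params k" using q by blast
    note af = attractor_facts[OF k]
    have "?g q \<in> lozi_tent.W (kap q) (nup q)"
      using lozi_tent.unstable_segment_in_W[OF tent_paramsD(1)[OF k] t(1)] unfolding af(1,2) .
    then show ?thesis using closure_subset af(3) by blast
  qed
  then have "\<forall>\<^sub>F q in at p within (\<Union>m. tent_params m). ?g q \<in> lozi_attractor q"
    by (auto simp: eventually_at_filter)
  ultimately show ?thesis by eventually_elim blast
qed

text \<open>Finitely many points of W are e/2-dense in the compact attractor, and each is followed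
  separately, with another error of e/2.\<close>

lemma attractor_lower:
  assumes p: "p \<in> tent_params m" and e: "0 < e"
  shows "\<forall>\<^sub>F q in at p within (\<Union>m. tent_params m). \<forall>z\<in>lozi_attractor p. \<exists>w\<in>lozi_attractor q. dist z w \<le> e"
proof -
  let ?W = "lozi_tent.W (kap p) (nup p)"
  have cov: "lozi_attractor p \<subseteq> (\<Union>w\<in>?W. ball w (e / 2))"
  proof
    fix z assume "z \<in> lozi_attractor p"
    then have "z \<in> closure ?W" using attractor_facts(3)[OF p] by simp
    then obtain w where "w \<in> ?W" "dist w z < e / 2" using e unfolding closure_approachable by (meson half_gt_zero)
    then show "z \<in> (\<Union>w\<in>?W. ball w (e / 2))" by auto
  qed
  obtain T where T: "T \<subseteq> ?W" "finite T" "lozi_attractor p \<subseteq> (\<Union>w\<in>T. ball w (e / 2))"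
    using compactE_image[OF lozi_attractor_compact(1)[OF p] _ cov] by (metis open_ball)
  have "\<forall>\<^sub>F q in at p within (\<Union>m. tent_params m). \<forall>w\<in>T. \<exists>w'\<in>lozi_attractor q. dist w' w < e / 2"
  proof (rule eventually_ball_finite[OF T(2)], rule ballI)
    fix w assume "w \<in> T"
    then show "\<forall>\<^sub>F q in at p within (\<Union>m. tent_params m). \<exists>w'\<in>lozi_attractor q. dist w' w < e / 2"
      using T(1) e by (intro attractor_lower_point[OF p]) auto
  qed
  then show ?thesis
  proof eventually_elim
    case (elim q)
    show ?case
    proof
      fix z assume "z \<in> lozi_attractor p"
      then obtain w where w: "w \<in> T" "dist w z < e / 2" using T(3) by auto
      then obtain w' where w': "w' \<in> lozi_attractor q" "dist w' w < e / 2" using elim by blast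
      have "dist z w' \<le> dist w z + dist w' w" by (metis dist_commute dist_triangle)
      then show "\<exists>w\<in>lozi_attractor q. dist z w \<le> e" using w w' by (intro bexI[of _ w']) auto
    qed
  qed
qed

lemma attractor_continuous:
  assumes p: "p \<in> tent_params m"
  shows "((\<lambda>q. hausdorff_distance (lozi_attractor q) (lozi_attractor p)) \<longlongrightarrow> 0)
      (at p within (\<Union>m. tent_params m))"
proof (rule tendstoI)
  fix e :: real assume e: "0 < e"
  then have e2: "0 < e / 2" by simp
  have "\<forall>\<^sub>F q in at p within (\<Union>m. tent_params m). q \<in> (\<Union>m. tent_params m)"
    by (auto simp: eventually_at_filter)
  with attractor_upper[OF p e2] attractor_lower[OF p e2]
  show "\<forall>\<^sub>F q in at p within (\<Union>m. tent_params m).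
      dist (hausdorff_distance (lozi_attractor q) (lozi_attractor p)) 0 < e"
  proof eventually_elim
    case (elim q)
    then obtain k where k: "q \<in> tent_params k" by blast
    have "0 \<le> hausdorff_distance (lozi_attractor q) (lozi_attractor p)"
      "hausdorff_distance (lozi_attractor q) (lozi_attractor p) \<le> e / 2"
      by (rule hausdorff_distance_le[OF lozi_attractor_compact(2)[OF k] lozi_attractor_compact(2)[OF p]
          compact_imp_bounded[OF lozi_attractor_compact(1)[OF k]] compact_imp_bounded[OF lozi_attractor_compact(1)[OF p]],
          of "e / 2"]; use elim in \<open>force simp: dist_commute\<close>)+
    then show ?case using e by simp
  qed
qed

section \<open>Position of the parameter set\<close>

lemma tent_params_U_minus:
  assumes "p \<in> tent_params m"
  shows "p \<in> U_minus"
proof -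
  interpret lozi_tent "kap p" "nup p" m by (rule tent_paramsD(1)[OF assms])
  define a b where "a = fst p" and "b = snd p"
  have ab: "a = kap p + nup p" "b = - (kap p * nup p)"
    using tent_paramsD(2,3)[OF assms] by (simp_all add: a_def b_def)
  have a: "199/100 < a" "a < 2" "999 * nup p \<le> 2 - a" using ab kappa nu by linarith+
  have b: "b < 0" "- (2 * nup p) \<le> b" using ab kappa_nu by linarith+
  have s: "141/100 \<le> sqrt 2" by (rule real_le_rsqrt) (simp add: power2_eq_square)
  have s2: "sqrt 2 \<le> 3/2" by (rule real_le_lsqrt) (simp_all add: power2_eq_square)
  have "141/100 * (199/100) \<le> sqrt 2 * a" using s a by (intro mult_mono) auto
  then have 1: "2 - sqrt 2 * a < b" using b nu_small by linarith
  \<comment> \<open>After squaring, the inequality becomes 4 b^2 + a (8 - 3 a) b + 2 a^2 (2 - a) >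
    0. The middle term is at least -12\<nu>, while the last exceeds it by far because 999\<nu> \<le>
    2 - a.\<close>
  have "sqrt (9 * a ^ 4 - 16 * a ^ 3) < 8 * b - 3 * a\<^sup>2 + 8 * a"
  proof (rule real_less_lsqrt)
    have "a * (199/100) \<le> a * a" "a * a \<le> a * 2" using a by (intro mult_left_mono; simp)+
    then show "0 \<le> 8 * b - 3 * a\<^sup>2 + 8 * a" using a b nu_small unfolding power2_eq_square by linarith
    have "(a * (8 - 3 * a)) * (2 * nup p) \<le> (2 * 3) * (2 * nup p)"
      using a nu by (intro mult_right_mono mult_mono) auto
    moreover have "a * (8 - 3 * a) * (- (2 * nup p)) \<le> a * (8 - 3 * a) * b"
      using a b by (intro mult_left_mono) auto
    moreover have "3 * (999 * nup p) \<le> (a * a) * (2 - a)"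
    proof (rule mult_mono)
      have "199/100 * (199/100) \<le> a * a" using a by (intro mult_mono) auto
      then show "3 \<le> a * a" by simp
    qed (use a nu in auto)
    ultimately have "0 < 4 * (b * b) + a * (8 - 3 * a) * b + 2 * ((a * a) * (2 - a))"
      using nu zero_le_square[of b] by linarith
    moreover have "(8 * b - 3 * a\<^sup>2 + 8 * a)\<^sup>2 - (9 * a ^ 4 - 16 * a ^ 3)
        = 16 * (4 * (b * b) + a * (8 - 3 * a) * b + 2 * ((a * a) * (2 - a)))"
      by (simp add: power2_eq_square power4_eq_xxxx power3_eq_cube algebra_simps)
    ultimately show "9 * a ^ 4 - 16 * a ^ 3 < (8 * b - 3 * a\<^sup>2 + 8 * a)\<^sup>2" by argo
  qed
  then have 2: "(3 * a\<^sup>2 - 8 * a + sqrt (9 * a ^ 4 - 16 * a ^ 3)) / 8 < b" by simp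
  have "(a, b) \<in> U_minus" using 1 2 a b s2 by (simp add: U_minus_def)
  then show ?thesis by (simp add: a_def b_def)
qed

lemma tent_params_accumulate: "(2, 0) islimpt (\<Union>m. tent_params m)"
  unfolding islimpt_approachable
proof (intro allI impI)
  fix e :: real assume e: "0 < e"
  have "(\<lambda>n. of_nat n * (1/2::real) ^ n) \<longlonglongrightarrow> 0" by (rule powser_times_n_limit_0) simp
  moreover define c where "c = min (1/100) (e / 4)"
  have "0 < c" using e by (simp add: c_def)
  ultimately have "\<forall>\<^sub>F n in sequentially. of_nat n * (1/2::real) ^ n < c" by (rule order_tendstoD(2))
  then obtain N where N: "\<And>n. N \<le> n \<Longrightarrow> of_nat n * (1/2::real) ^ n < c" by (auto simp: eventually_sequentially)
  define m where "m = N"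
  \<comment> \<open>With 2 - \<kappa> = \<delta> this makes 2 ^ (m + 1) * (2 - \<kappa>) equal to
    the upper bound 16/25. Replacing 2 by \<kappa> multiplies it by (1 - \<delta>/2) ^ (m + 1),
    slightly below 1, where the choice of m makes (m + 1) \<delta> < 1/100. The value \<delta>/2000
    for \<nu> is half of what is allowed.\<close>
  define \<delta> :: real where "\<delta> = 16/25 * (1/2) ^ (m + 1)"
  define \<kappa> \<nu> where "\<kappa> = 2 - \<delta>" and "\<nu> = \<delta> / 2000"
  have h: "of_nat (m + 1) * (1/2::real) ^ (m + 1) < c" using N[of "m + 1"] by (simp add: m_def)
  have "1 * (1/2::real) ^ (m + 1) \<le> of_nat (m + 1) * (1/2) ^ (m + 1)" by (intro mult_right_mono) auto
  moreover have "0 < (1/2::real) ^ (m + 1)" by simp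
  ultimately have d: "0 < \<delta>" "\<delta> < c" using h unfolding \<delta>_def by linarith+
  have dc: "\<delta> < 1/100" "\<delta> < e / 4" using d by (auto simp: c_def)
  define p where "p = (\<kappa> + \<nu>, - (\<kappa> * \<nu>))"
  have "(fst p)\<^sup>2 + 4 * snd p = (\<kappa> - \<nu>)\<^sup>2" by (simp add: p_def power2_eq_square algebra_simps)
  moreover have kn: "0 < \<kappa> - \<nu>" "0 < \<nu>" "0 < \<kappa>" using dc d by (simp_all add: \<kappa>_def \<nu>_def)
  ultimately have sq: "sqrt ((fst p)\<^sup>2 + 4 * snd p) = \<kappa> - \<nu>" "0 < (fst p)\<^sup>2 + 4 * snd p" by simp_all
  have k: "kap p = \<kappa>" "nup p = \<nu>" unfolding kap_def nup_def sq by (simp_all add: p_def)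
  have "\<kappa> = 2 * (1 + - \<delta> / 2)" by (simp add: \<kappa>_def)
  then have "\<kappa> ^ (m + 1) * (2 - \<kappa>) = (1 + - \<delta> / 2) ^ (m + 1) * (2 ^ (m + 1) * \<delta>)"
    by (simp only: power_mult_distrib) (simp add: \<kappa>_def)
  also have "2 ^ (m + 1) * \<delta> = 16/25" unfolding \<delta>_def by (simp add: power_one_over)
  finally have pw: "\<kappa> ^ (m + 1) * (2 - \<kappa>) = (1 + - \<delta> / 2) ^ (m + 1) * (16/25)" .
  have "1 + of_nat (m + 1) * (- \<delta> / 2) \<le> (1 + - \<delta> / 2) ^ (m + 1)"
    using dc by (intro Bernoulli_inequality) simp
  have "of_nat (m + 1) * \<delta> = 16/25 * (of_nat (m + 1) * (1/2) ^ (m + 1))" by (simp add: \<delta>_def)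
  moreover have "c \<le> 1/100" by (simp add: c_def)
  ultimately have "of_nat (m + 1) * \<delta> < 1/100" using h by linarith
  moreover note \<open>1 + of_nat (m + 1) * (- \<delta> / 2) \<le> (1 + - \<delta> / 2) ^ (m + 1)\<close>
  ultimately have "1 - 1/200 \<le> (1 + - \<delta> / 2) ^ (m + 1)" by simp
  then have lo: "63/100 < \<kappa> ^ (m + 1) * (2 - \<kappa>)" unfolding pw by simp
  have "(1 + - \<delta> / 2) ^ (m + 1) < 1" using d dc by (intro power_Suc_less_one[of _ m, unfolded Suc_eq_plus1]) auto
  then have hi: "\<kappa> ^ (m + 1) * (2 - \<kappa>) < 16/25" unfolding pw by simp
  have "p \<in> tent_params m"
    unfolding tent_params_def mem_Collect_eq k
    using sq(2) lo hi kn dc d by (auto simp: p_def \<kappa>_def \<nu>_def)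
  moreover have "p \<noteq> (2, 0)" using kn by (simp add: p_def)
  moreover have "dist p (2, 0) < e"
  proof -
    have "\<kappa> * \<nu> \<le> 2 * \<nu>" using d by (intro mult_right_mono) (auto simp: \<kappa>_def \<nu>_def)
    moreover have "0 < \<kappa> * \<nu>" using kn by simp
    moreover have "dist p (2, 0) \<le> \<bar>\<kappa> + \<nu> - 2\<bar> + \<bar>- (\<kappa> * \<nu>)\<bar>"
      using sqrt_sum_squares_le_sum_abs[of "\<kappa> + \<nu> - 2" "- (\<kappa> * \<nu>)"] by (simp add: p_def dist_prod_def dist_real_def)
    ultimately show ?thesis using dc d unfolding \<kappa>_def \<nu>_def by linarith
  qed
  ultimately show "\<exists>p\<in>\<Union>m. tent_params m. p \<noteq> (2, 0) \<and> dist p (2, 0) < e" by blast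
qed

theorem theorem2:
  shows "\<exists>U_tan :: (real \<times> real) set.
    open U_tan \<and> U_tan \<subseteq> U_minus \<and> (2, 0) islimpt U_tan \<and>
    (\<forall>p\<in>U_tan. strange_attractor (lozi p) (lozi_attractor p)) \<and>
    (\<forall>p\<in>U_tan. ((\<lambda>q. hausdorff_distance (lozi_attractor q) (lozi_attractor p)) \<longlongrightarrow> 0)
      (at p within U_tan))"
proof (intro exI conjI)
  show "open (\<Union>m. tent_params m)" using open_tent_params by blast
  show "(\<Union>m. tent_params m) \<subseteq> U_minus" using tent_params_U_minus by blast
  show "(2, 0) islimpt (\<Union>m. tent_params m)" by (rule tent_params_accumulate)
  show "\<forall>p\<in>\<Union>m. tent_params m. strange_attractor (lozi p) (lozi_attractor p)"
    using lozi_attractor_strange by blast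
  show "\<forall>p\<in>\<Union>m. tent_params m.
      ((\<lambda>q. hausdorff_distance (lozi_attractor q) (lozi_attractor p)) \<longlongrightarrow> 0)
        (at p within (\<Union>m. tent_params m))"
    using attractor_continuous by blast
qed

end
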